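(* Let $\mathbb{K}$ be an infinite field and let $a_1,a_2,a_3,a_4\in\mathbb{K}[s,t]$ be polynomials of total degree bounded by $\delta_a$. Suppose that the ideal $I=\langle a_1,a_2,a_3,a_4\rangle$ is a proper ideal which has a shape basis, i.e. $I=\langle p,q\rangle$ with $p=t-r$ and $q$, where $r,q\in\mathbb{K}[s]$ and $\gcd(p,q)=1$, and that $p,q$ have degrees bounded by $\delta_0$. Then a basis of the $\mathbb{K}[s,t]$-module $\mathrm{Syz}(a_1,a_2,a_3,a_4)$ can be found whose elements have degree bounded by $$192(\delta_0\delta_a+1)^{4}.$$
   Context: $\mathrm{Syz}(a_1,\ldots,a_4)=\{(u_1,\ldots,u_4)\in\mathbb{K}[s,t]^4:\sum_i u_ia_i=0\}$. The degree of a vector of polynomials is the maximum of the total degrees of its entries. *)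

theory Defs
  imports "HOL-Computational_Algebra.Polynomial" "HOL-Analysis.Analysis"
begin

text \<open>
  The ring \<open>K[s,t]\<close> is the type of polynomials in \<open>t\<close> over \<open>K[s]\<close>: the coefficient of
  \<open>s^j t^i\<close> in \<open>f\<close> is \<open>coeff (coeff f i) j\<close>, the subring \<open>K[s]\<close> consists of the constant
  polynomials \<open>[:g:]\<close>, and the variable \<open>t\<close> is \<open>[:0, 1:]\<close>.
\<close>

type_synonym 'k poly2 = "'k poly poly"

abbreviation (input) of_s :: "'k::comm_ring_1 poly \<Rightarrow> 'k poly2" where
  "of_s g \<equiv> [:g:]"

abbreviation (input) var_t :: "'k::comm_ring_1 poly2" where
  "var_t \<equiv> [:0, 1:]"

text \<open>The zero polynomial gets total degree \<open>0\<close>, as for \<^const>\<open>degree\<close>.\<close>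

definition total_degree :: "'k::zero poly2 \<Rightarrow> nat" where
  "total_degree f = Max (insert 0 {i + j |i j. coeff (coeff f i) j \<noteq> 0})"

definition vec_degree :: "'k::zero poly2 ^ 'n \<Rightarrow> nat" where
  "vec_degree v = Max (range (\<lambda>i. total_degree (v $ i)))"

lemma finite_total_degree_set: "finite {i + j |i j. coeff (coeff f i) j \<noteq> 0}"
proof (rule finite_subset)
  show "{i + j |i j. coeff (coeff f i) j \<noteq> 0}
      \<subseteq> (\<Union>i\<le>degree f. (\<lambda>j. i + j) ` {..degree (coeff f i)})"
    by (auto intro!: bexI imageI le_degree)
qed simp

lemma total_degree_le_iff:
  "total_degree f \<le> d \<longleftrightarrow> (\<forall>i j. coeff (coeff f i) j \<noteq> 0 \<longrightarrow> i + j \<le> d)"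
  unfolding total_degree_def using finite_total_degree_set[of f] by auto

lemma vec_degree_le_iff: "vec_degree v \<le> d \<longleftrightarrow> (\<forall>i. total_degree (v $ i) \<le> d)"
  unfolding vec_degree_def by auto

text \<open>
  Ideals of a commutative ring are its submodules, and submodules of \<open>R^n\<close> are taken with
  respect to the componentwise scalar multiplication.
\<close>

lemma module_times: "module ((*) :: 'r::comm_ring_1 \<Rightarrow> 'r \<Rightarrow> 'r)"
  by unfold_locales (simp_all add: algebra_simps)

lemma module_vector_scalar_mult: "module ((*s) :: 'r::comm_ring_1 \<Rightarrow> 'r ^ 'n \<Rightarrow> 'r ^ 'n)"
  by unfold_locales (simp_all add: vec_eq_iff vector_scalar_mult_def algebra_simps)

definition ideal_gen :: "'r::comm_ring_1 set \<Rightarrow> 'r set" where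
  "ideal_gen S = module.span (*) S"

definition Syz :: "'r::comm_ring_1 ^ 'n \<Rightarrow> ('r ^ 'n) set" where
  "Syz a = {u. (\<Sum>i\<in>UNIV. u $ i * a $ i) = 0}"

definition module_basis :: "('r::comm_ring_1 ^ 'n) set \<Rightarrow> ('r ^ 'n) set \<Rightarrow> bool" where
  "module_basis M B \<longleftrightarrow> \<not> module.dependent (*s) B \<and> module.span (*s) B = M"

definition is_shape_basis :: "'k::field poly2 set \<Rightarrow> 'k poly2 \<Rightarrow> 'k poly2 \<Rightarrow> bool" where
  "is_shape_basis I p q \<longleftrightarrow>
     (\<exists>r g. p = var_t - of_s r \<and> q = of_s g) \<and> coprime p q \<and> I = ideal_gen {p, q}"

end

theory Submission
  imports Defs
begin

text \<open>
  Write \<open>I = \<langle>t - r, g\<rangle>\<close>. Substituting \<open>t + r\<close> for \<open>t\<close> turns this into \<open>\<langle>t, g\<rangle>\<close>. The entries of \<open>a\<close>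
  are then \<open>\<beta>\<^sub>i g\<close> modulo \<open>t\<close> with \<open>\<beta>\<close> unimodular over \<open>K[s]\<close>, and elementary operations make
  all entries but one divisible by \<open>t\<close>, the remaining one being \<open>g\<close> modulo \<open>t\<close>. A syzygy has
  its coefficient at the latter divisible by \<open>t\<close>, so dividing by \<open>t\<close> identifies the syzygies
  with those of a unimodular row of length four.

  For such a row, a linear change of variables makes one entry \<open>x\<close> monic in \<open>t\<close>. Since \<open>K\<close> is
  infinite, generic \<open>K\<close>-linear combinations \<open>y\<close>, \<open>z\<close> of the entries generate the unit ideal
  together with \<open>x\<close>: first \<open>\<langle>x, y\<rangle>\<close> is made to contain a nonzero \<open>\<rho> \<in> K[s]\<close>, whose degree is
  bounded by counting dimensions, and then \<open>z\<close> is made invertible modulo \<open>\<langle>x, \<rho>\<rangle>\<close>. Reducing the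
  inverse modulo \<open>x\<close> and \<open>\<rho>\<close> bounds the coefficients in \<open>1 = h\<^sub>1 x + h\<^sub>2 y + h\<^sub>3 z\<close>. The fourth
  entry can therefore be replaced by \<open>1\<close>, and then a basis of the syzygies is evident.
\<close>

subsection \<open>Total degree and substitution\<close>

lemma total_degree_coeff_le: "coeff (coeff f i) j \<noteq> 0 \<Longrightarrow> i + j \<le> total_degree f"
  using total_degree_le_iff by blast

lemma total_degree_0 [simp]: "total_degree 0 = 0"
  using total_degree_le_iff[of 0 0] by simp

lemma total_degree_const: "total_degree [:g:] \<le> degree g"
  by (auto simp: total_degree_le_iff coeff_pCons le_degree split: nat.splits)

lemma exists_coeff_total_degree:
  assumes "f \<noteq> 0"
  shows "\<exists>i j. coeff (coeff f i) j \<noteq> 0 \<and> i + j = total_degree f"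
proof (rule ccontr)
  assume *: "\<not> ?thesis"
  have "\<exists>i j. coeff (coeff f i) j \<noteq> 0"
    using assms by (metis leading_coeff_0_iff)
  then have "0 < total_degree f"
    using * total_degree_coeff_le[of f] by fastforce
  moreover have "total_degree f \<le> total_degree f - 1"
    unfolding total_degree_le_iff[of f "total_degree f - 1"]
  proof (intro allI impI)
    fix i j assume "coeff (coeff f i) j \<noteq> 0"
    then show "i + j \<le> total_degree f - 1"
      using * total_degree_coeff_le[of f i j] by fastforce
  qed
  ultimately show False by linarith
qed

lemma degree_coeff_le_total_degree: "degree (coeff f i) \<le> total_degree f - i"
proof (cases "coeff f i = 0")
  case False
  then show ?thesis
    using total_degree_coeff_le[of f i "degree (coeff f i)"] by simp
qed simp

lemma degree_le_total_degree: "degree f \<le> total_degree f"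
  by (metis add_leE degree_0 le_degree leading_coeff_0_iff le0 total_degree_coeff_le)

lemma total_degree_add_le:
  "total_degree f \<le> d \<Longrightarrow> total_degree g \<le> d \<Longrightarrow> total_degree (f + g) \<le> d"
  by (metis (no_types, lifting) add.right_neutral coeff_add total_degree_le_iff)

lemma total_degree_minus [simp]: "total_degree (- f) = total_degree (f :: 'k::comm_ring_1 poly2)"
  unfolding total_degree_def by simp

lemma total_degree_diff_le:
  fixes f g :: "'k::comm_ring_1 poly2"
  shows "total_degree f \<le> d \<Longrightarrow> total_degree g \<le> d \<Longrightarrow> total_degree (f - g) \<le> d"
  using total_degree_add_le[of f d "- g"] by simp

lemma total_degree_sum_le:
  "(\<And>x. x \<in> A \<Longrightarrow> total_degree (f x) \<le> d) \<Longrightarrow> total_degree (sum f A) \<le> d"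
  by (induction A rule: infinite_finite_induct) (auto intro: total_degree_add_le)

lemma total_degree_mult_le:
  fixes f g :: "'k::comm_semiring_0 poly2"
  assumes "total_degree f \<le> d" "total_degree g \<le> e"
  shows "total_degree (f * g) \<le> d + e"
  unfolding total_degree_le_iff
proof (intro allI impI)
  fix i j
  assume "coeff (coeff (f * g) i) j \<noteq> 0"
  then have "(\<Sum>k\<le>i. \<Sum>l\<le>j. coeff (coeff f k) l * coeff (coeff g (i - k)) (j - l)) \<noteq> 0"
    by (simp add: coeff_mult coeff_sum)
  then obtain k where k: "k \<le> i"
    "(\<Sum>l\<le>j. coeff (coeff f k) l * coeff (coeff g (i - k)) (j - l)) \<noteq> 0"
    by (meson atMost_iff sum.not_neutral_contains_not_neutral)
  then obtain l where l: "l \<le> j" "coeff (coeff f k) l * coeff (coeff g (i - k)) (j - l) \<noteq> 0"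
    by (meson atMost_iff sum.not_neutral_contains_not_neutral)
  then have "coeff (coeff f k) l \<noteq> 0" "coeff (coeff g (i - k)) (j - l) \<noteq> 0"
    by auto
  then have "k + l \<le> d" "(i - k) + (j - l) \<le> e"
    using assms total_degree_le_iff by blast+
  then show "i + j \<le> d + e" using k(1) l(1) by linarith
qed

lemma total_degree_one [simp]: "total_degree (1 :: 'k::comm_semiring_1 poly2) = 0"
  using total_degree_const[of "1 :: 'k poly"] by (simp flip: one_pCons)

lemma total_degree_power_le:
  fixes f :: "'k::comm_semiring_1 poly2"
  assumes "total_degree f \<le> d"
  shows "total_degree (f ^ n) \<le> d * n"
  by (induction n) (auto intro: total_degree_mult_le[OF assms, THEN order_trans])

lemma total_degree_monom_monom_le: "total_degree (monom (monom c j) i) \<le> i + j"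
  by (auto simp: total_degree_le_iff)

text \<open>For each power of \<open>t\<close>, the leading coefficients in \<open>s\<close> of the
  two factors multiply to a nonzero element, so nothing cancels at the top. This bounds a cofactor
  of \<open>[:g:]\<close> by the product.\<close>

lemma total_degree_le_mult_const:
  fixes f :: "'k::idom poly2"
  assumes "g \<noteq> 0"
  shows "total_degree f \<le> total_degree (f * [:g:])"
  unfolding total_degree_le_iff
proof (intro allI impI)
  fix i j
  assume nz: "coeff (coeff f i) j \<noteq> 0"
  have c: "coeff (f * [:g:]) i = coeff f i * g"
    by (simp add: mult.commute)
  have "coeff f i \<noteq> 0" using nz by auto
  then have "coeff (coeff (f * [:g:]) i) (degree (coeff f i) + degree g) \<noteq> 0"
    using assms unfolding c by (simp flip: degree_mult_eq)
  then have "i + (degree (coeff f i) + degree g) \<le> total_degree (f * [:g:])"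
    by (rule total_degree_coeff_le)
  moreover have "j \<le> degree (coeff f i)" using nz by (rule le_degree)
  ultimately show "i + j \<le> total_degree (f * [:g:])" by linarith
qed

lemma total_degree_var_t_le:
  "total_degree (var_t :: 'k::comm_ring_1 poly2) \<le> 1"
  by (auto simp: total_degree_le_iff coeff_pCons split: nat.splits)

section \<open>Substitution for both variables\<close>

text \<open>The value \<open>f(X, Y)\<close>, with \<open>X\<close> in place of \<open>s\<close> and \<open>Y\<close> in place of \<open>t\<close>.\<close>

definition subst2 :: "'k::comm_ring_1 poly2 \<Rightarrow> 'k poly2 \<Rightarrow> 'k poly2 \<Rightarrow> 'k poly2" where
  "subst2 X Y f = poly (map_poly (\<lambda>g. poly (map_poly (\<lambda>c. [:[:c:]:]) g) X) f) Y"

lemma poly_map_poly_add: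
  fixes h :: "'a::comm_ring_1 \<Rightarrow> 'b::comm_ring_1"
  assumes "h 0 = 0" "\<And>x y. h (x + y) = h x + h y"
  shows "poly (map_poly h (f + g)) x = poly (map_poly h f) x + poly (map_poly h g) x"
proof -
  have "map_poly h (f + g) = map_poly h f + map_poly h g"
    by (rule poly_eqI) (simp add: coeff_map_poly assms)
  then show ?thesis by simp
qed

lemma poly_map_poly_mult:
  fixes h :: "'a::comm_ring_1 \<Rightarrow> 'b::comm_ring_1"
  assumes "h 0 = 0" "\<And>x y. h (x + y) = h x + h y" "\<And>x y. h (x * y) = h x * h y"
  shows "poly (map_poly h (f * g)) x = poly (map_poly h f) x * poly (map_poly h g) x"
proof (induction f)
  case (pCons a f)
  have "map_poly h (smult a g) = smult (h a) (map_poly h g)"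
    by (rule poly_eqI) (simp add: coeff_map_poly assms)
  then show ?case
    using pCons by (simp add: poly_map_poly_add assms map_poly_pCons algebra_simps)
qed simp

lemma subst2_0 [simp]: "subst2 X Y 0 = 0"
  by (simp add: subst2_def)

lemma subst2_pCons:
  "subst2 X Y (pCons g f) = poly (map_poly (\<lambda>c. [:[:c:]:]) g) X + Y * subst2 X Y f"
  by (simp add: subst2_def map_poly_pCons)

lemma subst2_add: "subst2 X Y (f + g) = subst2 X Y f + subst2 X Y g"
  unfolding subst2_def by (intro poly_map_poly_add) (simp_all add: poly_map_poly_add)

lemma subst2_mult: "subst2 X Y (f * g) = subst2 X Y f * subst2 X Y g"
  unfolding subst2_def by (intro poly_map_poly_mult) (simp_all add: poly_map_poly_add poly_map_poly_mult)

lemma subst2_1 [simp]: "subst2 X Y 1 = 1"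
  by (simp add: one_pCons subst2_pCons map_poly_pCons)

lemma subst2_sum: "subst2 X Y (sum f A) = (\<Sum>i\<in>A. subst2 X Y (f i))"
  by (induction A rule: infinite_finite_induct) (simp_all add: subst2_add)

text \<open>Because of this law, two substitutions are seen to be mutually inverse by computing the
  images of \<open>s\<close> and \<open>t\<close> only.\<close>

lemma subst2_subst2:
  "subst2 X' Y' (subst2 X Y f) = subst2 (subst2 X' Y' X) (subst2 X' Y' Y) f"
proof (induction f)
  case (pCons g f)
  have *: "subst2 X' Y' (poly (map_poly (\<lambda>c. [:[:c:]:]) g) X) =
        poly (map_poly (\<lambda>c. [:[:c:]:]) g) (subst2 X' Y' X)" for g
    by (induction g) (simp_all add: map_poly_pCons subst2_add subst2_mult subst2_pCons)
  then show ?case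
    using pCons by (simp add: subst2_pCons subst2_add subst2_mult)
qed simp

lemma subst2_const: "subst2 [:[:0, 1:]:] Y [:g:] = [:g:]"
proof -
  have "poly (map_poly (\<lambda>c. [:[:c:]:]) g) [:[:0, 1:]:] = [:g:]"
    by (induction g) (simp_all add: map_poly_pCons)
  then show ?thesis by (simp add: subst2_pCons)
qed

lemma subst2_id [simp]: "subst2 [:[:0, 1:]:] [:0, 1:] f = f"
proof (induction f)
  case (pCons g f)
  have "subst2 [:[:0, 1:]:] [:0, 1:] (pCons g f) = subst2 [:[:0, 1:]:] [:0, 1:] [:g:] + pCons 0 f"
    using pCons by (simp add: subst2_pCons)
  then show ?case by (simp add: subst2_const)
qed simp

lemma subst2_linear:
  "subst2 X Y [:[:c, d:], [:e:]:] = [:[:c:]:] + [:[:d:]:] * X + [:[:e:]:] * Y"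
  by (simp add: subst2_pCons map_poly_pCons)

lemma subst2_var_t: "subst2 X Y var_t = Y"
  using subst2_linear[of X Y 0 0 1] by (simp flip: one_pCons)

text \<open>Both indices run up to the total degree; the added terms have coefficient zero. This
  form serves for degree bounds and for reading off single coefficients.\<close>

lemma subst2_altdef:
  "subst2 X Y f =
     (\<Sum>i\<le>total_degree f. \<Sum>j\<le>total_degree f. [:[:coeff (coeff f i) j:]:] * X ^ j * Y ^ i)"
proof -
  have poly_alt: "poly (map_poly h g) x = (\<Sum>i\<le>n. h (coeff g i) * x ^ i)"
    if "h 0 = 0" "degree g \<le> n" for h :: "'b::comm_ring_1 \<Rightarrow> 'a poly2" and g x n
  proof -
    have "poly (map_poly h g) x = (\<Sum>i\<le>n. coeff (map_poly h g) i * x ^ i)"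
      unfolding poly_altdef using that map_poly_degree_leq[of h g]
      by (intro sum.mono_neutral_left) (auto simp: coeff_eq_0)
    then show ?thesis by (simp add: coeff_map_poly that)
  qed
  have "degree (coeff f i) \<le> total_degree f" for i
    using degree_coeff_le_total_degree[of f i] by linarith
  then show ?thesis
    unfolding subst2_def
    by (simp add: poly_alt[of _ _ "total_degree f"] degree_le_total_degree sum_distrib_right)
qed

lemma total_degree_subst2_le:
  assumes X: "total_degree X \<le> m" and Y: "total_degree Y \<le> m"
  shows "total_degree (subst2 X Y f) \<le> m * total_degree f"
  unfolding subst2_altdef
proof (intro total_degree_sum_le)
  fix i j
  show "total_degree ([:[:coeff (coeff f i) j:]:] * X ^ j * Y ^ i) \<le> m * total_degree f"
  proof (cases "coeff (coeff f i) j = 0")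
    case False
    have "total_degree ([:[:coeff (coeff f i) j:]:] * X ^ j * Y ^ i) \<le> 0 + m * j + m * i"
      using total_degree_const[of "[:coeff (coeff f i) j:]"]
      by (intro total_degree_mult_le total_degree_power_le X Y) auto
    also have "\<dots> = m * (i + j)" by (simp add: algebra_simps)
    also have "\<dots> \<le> m * total_degree f"
      using total_degree_coeff_le[OF False] by simp
    finally show ?thesis .
  qed simp
qed

subsection \<open>Ideals and bases of syzygy modules\<close>

lemma ideal_gen_insert:
  "x \<in> ideal_gen (insert u S) \<longleftrightarrow> (\<exists>k. x - k * u \<in> ideal_gen S)"
  unfolding ideal_gen_def by (rule module.span_breakdown_eq[OF module_times])

lemma ideal_gen_empty: "ideal_gen {} = {0}"
  unfolding ideal_gen_def by (rule module.span_empty[OF module_times])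

lemma ideal_gen_zero: "0 \<in> ideal_gen S"
  unfolding ideal_gen_def by (rule module.span_zero[OF module_times])

lemma ideal_gen_add: "x \<in> ideal_gen S \<Longrightarrow> y \<in> ideal_gen S \<Longrightarrow> x + y \<in> ideal_gen S"
  unfolding ideal_gen_def by (rule module.span_add[OF module_times])

lemma ideal_gen_diff: "x \<in> ideal_gen S \<Longrightarrow> y \<in> ideal_gen S \<Longrightarrow> x - y \<in> ideal_gen S"
  unfolding ideal_gen_def by (rule module.span_diff[OF module_times])

lemma ideal_gen_mult: "x \<in> ideal_gen S \<Longrightarrow> r * x \<in> ideal_gen S"
  unfolding ideal_gen_def by (rule module.span_scale[OF module_times])

lemma ideal_gen_sum: "(\<And>x. x \<in> A \<Longrightarrow> f x \<in> ideal_gen S) \<Longrightarrow> sum f A \<in> ideal_gen S"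
  unfolding ideal_gen_def by (rule module.span_sum[OF module_times])

lemma ideal_gen_base: "x \<in> S \<Longrightarrow> x \<in> ideal_gen S"
  unfolding ideal_gen_def by (rule module.span_base[OF module_times])

lemma ideal_gen_minimal:
  assumes "S \<subseteq> ideal_gen T" shows "ideal_gen S \<subseteq> ideal_gen T"
  using assms unfolding ideal_gen_def
  by (rule module.span_minimal[OF module_times]) (rule module.subspace_span[OF module_times])

text \<open>As a set, \<open>range\<close> merges equal entries of \<open>a\<close>; here the
  coefficients are indexed by position, as they are in a syzygy.\<close>

lemma ideal_gen_range:
  fixes a :: "'r::comm_ring_1 ^ 'n"
  shows "x \<in> ideal_gen (range (($) a)) \<longleftrightarrow> (\<exists>c. x = (\<Sum>i\<in>UNIV. c i * a $ i))"
proof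
  assume "x \<in> ideal_gen (range (($) a))"
  moreover have "ideal_gen (range (($) a)) \<subseteq> {x. \<exists>c. x = (\<Sum>i\<in>UNIV. c i * a $ i)}"
    unfolding ideal_gen_def
  proof (rule module.span_minimal[OF module_times])
    show "range (($) a) \<subseteq> {x. \<exists>c. x = (\<Sum>i\<in>UNIV. c i * a $ i)}"
    proof clarify
      fix j
      have "a $ j = (\<Sum>i\<in>UNIV. (if i = j then 1 else 0) * a $ i)"
        by (simp add: if_distrib[of "\<lambda>x. x * _"] cong: if_cong)
      then show "\<exists>c. a $ j = (\<Sum>i\<in>UNIV. c i * a $ i)" by (intro exI)
    qed
    show "module.subspace (*) {x. \<exists>c. x = (\<Sum>i\<in>UNIV. c i * a $ i)}"
    proof (rule module.subspaceI[OF module_times])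
      have "(0::'r) = (\<Sum>i\<in>UNIV. 0 * a $ i)" by simp
      then show "0 \<in> {x. \<exists>c. x = (\<Sum>i\<in>UNIV. c i * a $ i)}"
        by (intro CollectI exI[of _ "\<lambda>_. 0"])
    next
      fix x y assume "x \<in> {x. \<exists>c. x = (\<Sum>i\<in>UNIV. c i * a $ i)}"
        "y \<in> {x. \<exists>c. x = (\<Sum>i\<in>UNIV. c i * a $ i)}"
      then obtain c d where "x = (\<Sum>i\<in>UNIV. c i * a $ i)" "y = (\<Sum>i\<in>UNIV. d i * a $ i)" by blast
      then have "x + y = (\<Sum>i\<in>UNIV. (c i + d i) * a $ i)"
        by (simp add: distrib_right sum.distrib)
      then show "x + y \<in> {x. \<exists>c. x = (\<Sum>i\<in>UNIV. c i * a $ i)}"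
        by (intro CollectI exI)
    next
      fix r x assume "x \<in> {x. \<exists>c. x = (\<Sum>i\<in>UNIV. c i * a $ i)}"
      then obtain c where "x = (\<Sum>i\<in>UNIV. c i * a $ i)" by blast
      then have "r * x = (\<Sum>i\<in>UNIV. (r * c i) * a $ i)"
        by (simp add: sum_distrib_left mult.assoc)
      then show "r * x \<in> {x. \<exists>c. x = (\<Sum>i\<in>UNIV. c i * a $ i)}"
        by (intro CollectI exI)
    qed
  qed
  ultimately show "\<exists>c. x = (\<Sum>i\<in>UNIV. c i * a $ i)" by blast
next
  assume "\<exists>c. x = (\<Sum>i\<in>UNIV. c i * a $ i)"
  then show "x \<in> ideal_gen (range (($) a))"
    by (elim exE) (simp only:, intro ideal_gen_sum ideal_gen_mult ideal_gen_base rangeI)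
qed

lemma ideal_gen_mono: "S \<subseteq> T \<Longrightarrow> ideal_gen S \<subseteq> ideal_gen T"
  by (intro ideal_gen_minimal subsetI ideal_gen_base) auto

lemma ideal_gen_unit:
  assumes "u \<in> ideal_gen S" "v * u = 1"
  shows "ideal_gen S = UNIV"
proof -
  have "x * v * u \<in> ideal_gen S" for x using assms(1) by (rule ideal_gen_mult)
  then show ?thesis using assms(2) by (simp add: mult.assoc) blast
qed

text \<open>As \<open>h i = 0\<close>, the added sum involves only entries that stay unchanged, so
  \<open>a $ i\<close> is recovered by subtracting it again.\<close>

lemma ideal_gen_add_combination:
  fixes a a' :: "'r::comm_ring_1 ^ 'n"
  assumes "h i = 0" and a': "a' = (\<chi> k. if k = i then a $ i + (\<Sum>j\<in>UNIV. h j * a $ j) else a $ k)"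
  shows "ideal_gen (range (($) a)) \<subseteq> ideal_gen (range (($) a'))"
proof (rule ideal_gen_minimal, clarify)
  fix k
  have k: "a $ k \<in> ideal_gen (range (($) a'))" if "k \<noteq> i" for k
    using that ideal_gen_base[of "a' $ k" "range (($) a')"] by (simp add: a')
  have "a $ i = a' $ i - (\<Sum>j\<in>UNIV. h j * a $ j)" by (simp add: a')
  also have "\<dots> \<in> ideal_gen (range (($) a'))"
  proof (intro ideal_gen_diff ideal_gen_sum)
    fix j
    show "h j * a $ j \<in> ideal_gen (range (($) a'))"
      using k[of j] assms(1) by (cases "j = i") (auto intro: ideal_gen_mult ideal_gen_zero)
  qed (auto intro: ideal_gen_base)
  finally show "a $ k \<in> ideal_gen (range (($) a'))" using k by (cases "k = i") auto
qed

text \<open>The map is only semilinear, with scalars twisted by \<open>h\<close>, since a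
  substitution of variables acts on the scalars too. Surjectivity of \<open>h\<close> lets the
  coefficients of a relation among the images be pulled back.\<close>

lemma module_basis_image:
  fixes f :: "'r::comm_ring_1 ^ 'n \<Rightarrow> 'r ^ 'm"
  assumes B: "module_basis M B"
    and add: "\<And>u v. f (u + v) = f u + f v"
    and scale: "\<And>c v. f (c *s v) = h c *s f v"
    and "inj f" "surj h" "h 0 = 0"
  shows "module_basis (f ` M) (f ` B)"
proof -
  have ind: "\<not> module.dependent (*s) B" and spn: "module.span (*s) B = M"
    using B by (auto simp: module_basis_def)
  have f0: "f 0 = 0" using add[of 0 0] by simp
  have fsum: "f (sum g A) = (\<Sum>x\<in>A. f (g x))" for g :: "'r ^ 'n \<Rightarrow> 'r ^ 'n" and A
    by (induction A rule: infinite_finite_induct) (simp_all add: f0 add)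
  have "\<not> module.dependent (*s) (f ` B)"
  proof
    assume "module.dependent (*s) (f ` B)"
    then obtain t u where t: "finite t" "t \<subseteq> f ` B" "(\<Sum>v\<in>t. u v *s v) = 0" "\<exists>v\<in>t. u v \<noteq> 0"
      unfolding module.dependent_explicit[OF module_vector_scalar_mult] by blast
    then obtain t' where t': "finite t'" "t' \<subseteq> B" "t = f ` t'"
      by (meson finite_subset_image)
    define u' where "u' v = inv h (u (f v))" for v
    have hu: "h (u' v) = u (f v)" for v
      by (simp add: u'_def surj_f_inv_f[OF \<open>surj h\<close>])
    have inj: "inj_on f t'" using \<open>inj f\<close> by (auto simp: inj_on_def)
    have "f (\<Sum>v\<in>t'. u' v *s v) = (\<Sum>v\<in>t. u v *s v)"
      by (simp add: fsum scale hu t'(3) sum.reindex[OF inj])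
    then have "(\<Sum>v\<in>t'. u' v *s v) = 0"
      using t(3) f0 \<open>inj f\<close> by (metis injD)
    then have "\<forall>v\<in>t'. u' v = 0"
      using ind t' unfolding module.dependent_explicit[OF module_vector_scalar_mult] by blast
    then have "\<forall>v\<in>t. u v = 0" using hu \<open>h 0 = 0\<close> t'(3) by (metis imageE)
    then show False using t(4) by blast
  qed
  moreover have "module.span (*s) (f ` B) = f ` M"
  proof
    have "module.subspace (*s) (f ` M)"
    proof (rule module.subspaceI[OF module_vector_scalar_mult])
      have S: "module.subspace (*s) M"
        unfolding spn[symmetric] by (rule module.subspace_span[OF module_vector_scalar_mult])
      show "0 \<in> f ` M"
        using module.subspace_0[OF module_vector_scalar_mult S] f0 by force
      show "x + y \<in> f ` M" if "x \<in> f ` M" "y \<in> f ` M" for x y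
        using that module.subspace_add[OF module_vector_scalar_mult S] by (force simp flip: add)
      show "c *s x \<in> f ` M" if "x \<in> f ` M" for c x
      proof -
        from that obtain v where "v \<in> M" "x = f v" by blast
        moreover obtain d where "c = h d" using \<open>surj h\<close> by blast
        ultimately show ?thesis
          using module.subspace_scale[OF module_vector_scalar_mult S, of v d] by (force simp flip: scale)
      qed
    qed
    moreover have "B \<subseteq> M"
      unfolding spn[symmetric] by (rule module.span_superset[OF module_vector_scalar_mult])
    ultimately show "module.span (*s) (f ` B) \<subseteq> f ` M"
      by (intro module.span_minimal[OF module_vector_scalar_mult]) auto
    show "f ` M \<subseteq> module.span (*s) (f ` B)"
    proof clarify
      fix v assume "v \<in> M"
      then have "v \<in> module.span (*s) B" using spn by simp
      then show "f v \<in> module.span (*s) (f ` B)"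
      proof (induction rule: module.span_induct_alt[OF module_vector_scalar_mult, consumes 1])
        case 1
        show ?case unfolding f0 by (rule module.span_zero[OF module_vector_scalar_mult])
      next
        case (2 c x y)
        have "f x \<in> module.span (*s) (f ` B)"
          using 2(1) by (intro module.span_base[OF module_vector_scalar_mult]) auto
        then show ?case unfolding add scale
          by (intro module.span_add[OF module_vector_scalar_mult] 2
              module.span_scale[OF module_vector_scalar_mult])
      qed
    qed
  qed
  ultimately show ?thesis by (simp add: module_basis_def)
qed

text \<open>The degree bound is part of the predicate so that the cost of each change of the row can
  be tracked through a chain of reductions.\<close>

definition syz_basis_le :: "'k::comm_ring_1 poly2 ^ 'n \<Rightarrow> nat \<Rightarrow> bool" where
  "syz_basis_le a D \<longleftrightarrow> (\<exists>B. module_basis (Syz a) B \<and> (\<forall>v\<in>B. vec_degree v \<le> D))"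

lemma syz_basis_le_mono: "syz_basis_le a D \<Longrightarrow> D \<le> D' \<Longrightarrow> syz_basis_le a D'"
  unfolding syz_basis_le_def by (meson order_trans)

lemma syz_basis_le_image:
  fixes f :: "'k::comm_ring_1 poly2 ^ 'n \<Rightarrow> 'k poly2 ^ 'm"
  assumes "syz_basis_le a D" "Syz a' = f ` Syz a"
    and "\<And>u v. f (u + v) = f u + f v" "\<And>c v. f (c *s v) = h c *s f v"
    and "inj f" "surj h" "h 0 = 0"
    and deg: "\<And>v. vec_degree v \<le> D \<Longrightarrow> vec_degree (f v) \<le> D'"
  shows "syz_basis_le a' D'"
proof -
  obtain B where B: "module_basis (Syz a) B" "\<forall>v\<in>B. vec_degree v \<le> D"
    using assms(1) by (auto simp: syz_basis_le_def)
  then have "module_basis (Syz a') (f ` B)"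
    unfolding assms(2) by (intro module_basis_image[where h = h] assms) auto
  then show ?thesis using B(2) deg by (auto simp: syz_basis_le_def)
qed

section \<open>Changes of a row and their effect on its syzygies\<close>

lemma bij_swap: "bij (\<lambda>k. if k = i then j else if k = j then i else k)"
  by (rule involuntory_imp_bij) auto

lemma range_vec_bij:
  assumes "bij \<pi>"
  shows "range (($) (\<chi> i. a $ \<pi> i)) = range (($) a)"
proof -
  have "range (($) (\<chi> i. a $ \<pi> i)) = (($) a) ` range \<pi>" by auto
  then show ?thesis using assms by (simp add: bij_is_surj)
qed

lemma syz_basis_le_permute:
  fixes a :: "'k::comm_ring_1 poly2 ^ 'n" and \<pi> :: "'n \<Rightarrow> 'n"
  assumes "bij \<pi>" "syz_basis_le (\<chi> i. a $ \<pi> i) D"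
  shows "syz_basis_le a D"
proof (rule syz_basis_le_image[OF assms(2), where f = "\<lambda>u. \<chi> i. u $ inv \<pi> i" and h = id])
  have inv: "inv \<pi> (\<pi> i) = i" "\<pi> (inv \<pi> i) = i" for i
    using assms(1) by (auto simp: bij_def inv_f_f surj_f_inv_f)
  have sum: "(\<Sum>i\<in>UNIV. u $ i * a $ \<pi> i) = (\<Sum>i\<in>UNIV. u $ inv \<pi> i * a $ i)" for u :: "'k poly2 ^ 'n"
    using sum.reindex_bij_betw[OF assms(1), of "\<lambda>i. u $ inv \<pi> i * a $ i"] by (simp add: inv)
  show "Syz a = (\<lambda>u. \<chi> i. u $ inv \<pi> i) ` Syz (\<chi> i. a $ \<pi> i)"
  proof (intro equalityI subsetI)
    fix u assume u: "u \<in> Syz a"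
    have "(\<chi> i. u $ \<pi> i) \<in> Syz (\<chi> i. a $ \<pi> i)"
      using u by (simp add: Syz_def sum[of "\<chi> i. u $ \<pi> i", simplified] inv)
    moreover have "u = (\<chi> i. (\<chi> i. u $ \<pi> i) $ inv \<pi> i)" by (simp add: vec_eq_iff inv)
    ultimately show "u \<in> (\<lambda>u. \<chi> i. u $ inv \<pi> i) ` Syz (\<chi> i. a $ \<pi> i)" by blast
  qed (auto simp: Syz_def sum)
  show "inj (\<lambda>u :: 'k poly2 ^ 'n. \<chi> i. u $ inv \<pi> i)"
    by (rule injI) (metis inv(1) vec_eq_iff vec_lambda_beta)
qed (auto simp: vec_eq_iff vec_degree_le_iff)

text \<open>In a syzygy \<open>u\<close> of the new row, the entry at \<open>i\<close> also
  multiplies each \<open>h j * a $ j\<close>; collecting terms gives the syzygy of \<open>a\<close>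
  with entries \<open>u $ j + h j * u $ i\<close>. The entry at \<open>i\<close> is unchanged, hence
  subtraction is the inverse.\<close>

lemma syz_basis_le_add_combination:
  fixes a :: "'k::comm_ring_1 poly2 ^ 'n" and h :: "'n \<Rightarrow> 'k poly2"
  assumes "h i = 0" and a': "a' = (\<chi> k. if k = i then a $ i + (\<Sum>j\<in>UNIV. h j * a $ j) else a $ k)"
    and "syz_basis_le a' D" and hdeg: "\<And>j. total_degree (h j) \<le> m"
  shows "syz_basis_le a (D + m)"
proof (rule syz_basis_le_image[OF assms(3), where f = "\<lambda>u. \<chi> j. u $ j + h j * u $ i" and h = id])
  have sum: "(\<Sum>j\<in>UNIV. u $ j * a' $ j) = (\<Sum>j\<in>UNIV. (u $ j + h j * u $ i) * a $ j)" for u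
  proof -
    have "u $ j * a' $ j = u $ j * a $ j + (if j = i then u $ i * (\<Sum>j\<in>UNIV. h j * a $ j) else 0)" for j
      by (simp add: a' algebra_simps)
    then have "(\<Sum>j\<in>UNIV. u $ j * a' $ j)
        = (\<Sum>j\<in>UNIV. u $ j * a $ j) + u $ i * (\<Sum>j\<in>UNIV. h j * a $ j)"
      by (simp add: sum.distrib)
    also have "\<dots> = (\<Sum>j\<in>UNIV. (u $ j + h j * u $ i) * a $ j)"
      by (simp add: sum_distrib_left flip: sum.distrib) (simp add: algebra_simps)
    finally show ?thesis .
  qed
  show "Syz a = (\<lambda>u. \<chi> j. u $ j + h j * u $ i) ` Syz a'"
  proof (intro equalityI subsetI)
    fix u assume u: "u \<in> Syz a"
    have "(\<chi> j. u $ j - h j * u $ i) \<in> Syz a'"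
      using u by (simp add: Syz_def sum assms(1))
    moreover have "u = (\<chi> j. (\<chi> j. u $ j - h j * u $ i) $ j + h j * (\<chi> j. u $ j - h j * u $ i) $ i)"
      by (simp add: vec_eq_iff assms(1))
    ultimately show "u \<in> (\<lambda>u. \<chi> j. u $ j + h j * u $ i) ` Syz a'" by blast
  qed (auto simp: Syz_def sum)
  show "inj (\<lambda>u :: 'k poly2 ^ 'n. \<chi> j. u $ j + h j * u $ i)"
  proof (rule injI)
    fix u v :: "'k poly2 ^ 'n"
    assume eq: "(\<chi> j. u $ j + h j * u $ i) = (\<chi> j. v $ j + h j * v $ i)"
    then have *: "u $ j + h j * u $ i = v $ j + h j * v $ i" for j
      by (simp add: vec_eq_iff)
    have "u $ i = v $ i" using *[of i] assms(1) by simp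
    then show "u = v" using * by (simp add: vec_eq_iff)
  qed
  show "vec_degree (\<chi> j. v $ j + h j * v $ i) \<le> D + m" if "vec_degree v \<le> D" for v
  proof -
    have "total_degree (v $ j) \<le> D" for j using that by (simp add: vec_degree_le_iff)
    then have "total_degree (v $ j + h j * v $ i) \<le> D + m" for j
      using total_degree_mult_le[OF hdeg, of "v $ i" D j]
      by (intro total_degree_add_le) (auto simp: add.commute intro: trans_le_add1)
    then show ?thesis by (simp add: vec_degree_le_iff)
  qed
qed (auto simp: vec_eq_iff algebra_simps)

text \<open>An automorphism of the ring carries syzygies to syzygies. The degree cost is that of the
  substitution which leads back to \<open>a\<close>.\<close>

lemma syz_basis_le_subst2:
  fixes a :: "'k::comm_ring_1 poly2 ^ 'n"
  assumes inv: "\<And>f. subst2 X Y (subst2 X' Y' f) = f" "\<And>f. subst2 X' Y' (subst2 X Y f) = f"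
    and "syz_basis_le (\<chi> i. subst2 X Y (a $ i)) D"
    and deg: "total_degree X' \<le> m" "total_degree Y' \<le> m"
  shows "syz_basis_le a (m * D)"
proof (rule syz_basis_le_image[OF assms(3), where f = "\<lambda>u. \<chi> i. subst2 X' Y' (u $ i)" and h = "subst2 X' Y'"])
  show "Syz a = (\<lambda>u. \<chi> i. subst2 X' Y' (u $ i)) ` Syz (\<chi> i. subst2 X Y (a $ i))"
  proof (intro equalityI subsetI)
    fix u assume u: "u \<in> Syz a"
    have "(\<Sum>i\<in>UNIV. subst2 X Y (u $ i) * subst2 X Y (a $ i)) = subst2 X Y (\<Sum>i\<in>UNIV. u $ i * a $ i)"
      by (simp add: subst2_sum subst2_mult)
    then have "(\<chi> i. subst2 X Y (u $ i)) \<in> Syz (\<chi> i. subst2 X Y (a $ i))"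
      using u by (simp add: Syz_def)
    moreover have "u = (\<chi> i. subst2 X' Y' ((\<chi> i. subst2 X Y (u $ i)) $ i))" by (simp add: inv)
    ultimately show "u \<in> (\<lambda>u. \<chi> i. subst2 X' Y' (u $ i)) ` Syz (\<chi> i. subst2 X Y (a $ i))"
      by blast
  next
    fix u assume "u \<in> (\<lambda>u. \<chi> i. subst2 X' Y' (u $ i)) ` Syz (\<chi> i. subst2 X Y (a $ i))"
    then obtain v where v: "u = (\<chi> i. subst2 X' Y' (v $ i))"
        "(\<Sum>i\<in>UNIV. v $ i * subst2 X Y (a $ i)) = 0"
      by (auto simp: Syz_def)
    have "(\<Sum>i\<in>UNIV. u $ i * a $ i) = subst2 X' Y' (\<Sum>i\<in>UNIV. v $ i * subst2 X Y (a $ i))"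
      by (simp add: v(1) subst2_sum subst2_mult inv)
    then show "u \<in> Syz a" using v(2) by (simp add: Syz_def)
  qed
  show "inj (\<lambda>u :: 'k poly2 ^ 'n. \<chi> i. subst2 X' Y' (u $ i))"
    by (rule injI) (metis (mono_tags) inv(1) vec_eq_iff vec_lambda_beta)
  show "surj (subst2 X' Y')" using inv(2) by (metis surjI)
  show "vec_degree (\<chi> i. subst2 X' Y' (v $ i)) \<le> m * D" if "vec_degree v \<le> D" for v
    using that order_trans[OF total_degree_subst2_le[OF deg] mult_le_mono2]
    by (simp add: vec_degree_le_iff)
qed (auto simp: vec_eq_iff subst2_add subst2_mult)

text \<open>At \<open>t = 0\<close> a syzygy of \<open>a\<close> reduces to its \<open>i\<close>-th
  term, whose factor from \<open>a\<close> is nonzero in the domain \<open>K[s]\<close>. Hence its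
  \<open>i\<close>-th entry is divisible by \<open>t\<close>, and multiplying that entry by
  \<open>t\<close> maps the syzygies of \<open>c\<close> onto those of \<open>a\<close>.\<close>

lemma syz_basis_le_divide_t:
  fixes a c :: "'k::field poly2 ^ 'n"
  assumes ai: "c $ i = a $ i" "coeff (a $ i) 0 \<noteq> 0" and a: "\<And>k. k \<noteq> i \<Longrightarrow> a $ k = var_t * c $ k"
    and "syz_basis_le c D"
  shows "syz_basis_le a (D + 1)"
proof (rule syz_basis_le_image[OF assms(4), where h = id])
  define f :: "'k poly2 ^ 'n \<Rightarrow> 'k poly2 ^ 'n"
    where "f u = (\<chi> k. if k = i then var_t * u $ k else u $ k)" for u
  have sum: "(\<Sum>k\<in>UNIV. f u $ k * a $ k) = var_t * (\<Sum>k\<in>UNIV. u $ k * c $ k)" for u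
    unfolding sum_distrib_left by (intro sum.cong refl) (auto simp: f_def ai a mult_ac simp del: mult_pCons_left)
  show "Syz a = f ` Syz c"
  proof (intro equalityI subsetI)
    fix u assume u: "u \<in> Syz a"
    have "0 = coeff (\<Sum>k\<in>UNIV. u $ k * a $ k) 0" using u by (simp add: Syz_def)
    also have "\<dots> = (\<Sum>k\<in>UNIV. if k = i then coeff (u $ i) 0 * coeff (a $ i) 0 else 0)"
      unfolding coeff_sum by (intro sum.cong refl) (auto simp: coeff_mult a)
    finally have "coeff (u $ i) 0 = 0" using ai(2) by simp
    then obtain w where w: "u $ i = var_t * w" by (cases "u $ i") auto
    define v where "v = (\<chi> k. if k = i then w else u $ k)"
    have fv: "f v = u" by (auto simp: vec_eq_iff f_def v_def w)
    have "(\<Sum>k\<in>UNIV. v $ k * c $ k) = 0"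
      using sum[of v] u unfolding fv by (simp add: Syz_def)
    then show "u \<in> f ` Syz c" using fv by (force simp: Syz_def)
  qed (auto simp: Syz_def sum simp del: mult_pCons_left)
  show "f (u + v) = f u + f v" for u v by (simp add: f_def vec_eq_iff)
  show "f (k *s v) = id k *s f v" for k v
    by (simp add: f_def vec_eq_iff)
  show "inj f"
  proof (rule injI)
    fix u v assume "f u = f v"
    then have *: "f u $ k = f v $ k" for k by simp
    have "u $ k = v $ k" for k
      using *[of k] by (cases "k = i") (simp_all add: f_def)
    then show "u = v" by (simp add: vec_eq_iff)
  qed
  show "vec_degree (f v) \<le> D + 1" if "vec_degree v \<le> D" for v
    using that total_degree_mult_le[OF total_degree_var_t_le, of "v $ i" D]
    by (auto simp: vec_degree_le_iff f_def add.commute intro: le_SucI simp del: mult_pCons_left)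
qed auto

text \<open>With \<open>a $ i = 1\<close> the entries of a syzygy outside \<open>i\<close> are
  arbitrary and determine the one at \<open>i\<close>, so the vectors
  \<open>axis j 1 - a $ j *s axis i 1\<close> for \<open>j \<noteq> i\<close> form a basis.\<close>

lemma syz_basis_le_unit_entry:
  fixes a :: "'k::comm_ring_1 poly2 ^ 'n"
  assumes "a $ i = 1" "\<And>j. total_degree (a $ j) \<le> D"
  shows "syz_basis_le a D"
proof -
  define b where "b j = axis j 1 - a $ j *s axis i (1 :: 'k poly2)" for j
  have b: "b j $ k = (if k = j then 1 else 0) - a $ j * (if k = i then 1 else 0)" for j k
    by (simp add: b_def axis_def)
  have inj: "inj_on b (- {i})"
  proof (rule inj_onI)
    fix j k assume "j \<in> - {i}" "k \<in> - {i}" "b j = b k"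
    then have "b j $ j = b k $ j" "j \<noteq> i" by auto
    then show "j = k" by (simp add: b split: if_splits)
  qed
  have dep: "\<not> module.dependent (*s) (b ` (- {i}))"
  proof
    assume "module.dependent (*s) (b ` (- {i}))"
    then obtain u where u: "(\<Sum>v\<in>b ` (- {i}). u v *s v) = 0" "\<exists>v\<in>b ` (- {i}). u v \<noteq> 0"
      by (auto simp: module.dependent_finite[OF module_vector_scalar_mult])
    then obtain k where k: "k \<noteq> i" "u (b k) \<noteq> 0" by auto
    have "0 = (\<Sum>j\<in>- {i}. u (b j) *s b j) $ k"
      using u(1) by (simp add: sum.reindex[OF inj])
    also have "\<dots> = (\<Sum>j\<in>- {i}. if j = k then u (b j) else 0)"
      unfolding sum_component using k(1) by (intro sum.cong) (auto simp: b)
    also have "\<dots> = u (b k)" using k(1) by simp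
    finally show False using k(2) by simp
  qed
  have "module.span (*s) (b ` (- {i})) = Syz a"
  proof
    have "module.subspace (*s) (Syz a)"
      by (rule module.subspaceI[OF module_vector_scalar_mult])
        (simp_all add: Syz_def distrib_right sum.distrib mult.assoc flip: sum_distrib_left)
    moreover have "b ` (- {i}) \<subseteq> Syz a"
      by (auto simp: Syz_def b left_diff_distrib sum_subtractf if_distrib[of "\<lambda>x. _ * x"]
          if_distrib[of "\<lambda>x. x * _"] assms(1) cong: if_cong)
    ultimately show "module.span (*s) (b ` (- {i})) \<subseteq> Syz a"
      by (rule module.span_minimal[OF module_vector_scalar_mult, rotated])
    show "Syz a \<subseteq> module.span (*s) (b ` (- {i}))"
    proof
      fix u assume "u \<in> Syz a"
      then have "0 = (\<Sum>j\<in>UNIV. u $ j * a $ j)" by (simp add: Syz_def)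
      also have "\<dots> = u $ i + (\<Sum>j\<in>- {i}. u $ j * a $ j)"
        by (subst sum.remove[of UNIV i]) (simp_all add: assms(1) Compl_eq_Diff_UNIV)
      finally have ui: "u $ i = - (\<Sum>j\<in>- {i}. u $ j * a $ j)"
        by (simp add: eq_neg_iff_add_eq_0)
      have "u = (\<Sum>j\<in>- {i}. u $ j *s b j)"
      proof (rule vec_eq_iff[THEN iffD2], rule)
        fix k
        show "u $ k = (\<Sum>j\<in>- {i}. u $ j *s b j) $ k"
        proof (cases "k = i")
          case True
          then show ?thesis by (simp add: ui b sum_negf[symmetric] cong: sum.cong)
              (auto intro!: sum.cong)
        next
          case False
          then have "(\<Sum>j\<in>- {i}. u $ j *s b j) $ k = (\<Sum>j\<in>- {i}. if j = k then u $ j else 0)"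
            unfolding sum_component by (intro sum.cong) (auto simp: b)
          then show ?thesis using False by simp
        qed
      qed
      also have "\<dots> \<in> module.span (*s) (b ` (- {i}))"
        by (intro module.span_sum[OF module_vector_scalar_mult]
            module.span_scale[OF module_vector_scalar_mult] module.span_base[OF module_vector_scalar_mult]) auto
      finally show "u \<in> module.span (*s) (b ` (- {i}))" .
    qed
  qed
  moreover have "vec_degree (b j) \<le> D" for j
    unfolding vec_degree_le_iff b using assms(2)[of j] by (intro allI total_degree_diff_le) auto
  ultimately show ?thesis
    using dep by (auto simp: syz_basis_le_def module_basis_def)
qed

subsection \<open>Generic linear combinations\<close>

text \<open>This is the dimension bound for families instead of sets: two equal members already give
  a relation with coefficients \<open>1\<close> and \<open>- 1\<close>.\<close>

lemma (in vector_space) exists_linear_relation: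
  assumes "finite T" "finite I" "card T < card I" "\<And>i. i \<in> I \<Longrightarrow> f i \<in> span T"
  shows "\<exists>k. (\<exists>i\<in>I. k i \<noteq> 0) \<and> (\<Sum>i\<in>I. scale (k i) (f i)) = 0"
proof (cases "inj_on f I")
  case True
  have "dependent (f ` I)"
  proof (rule ccontr)
    assume "\<not> dependent (f ` I)"
    then have "card (f ` I) \<le> card T"
      using assms independent_span_bound[of T "f ` I"] by auto
    then show False using assms(3) by (simp add: card_image True)
  qed
  then obtain u where "(\<Sum>v\<in>f ` I. scale (u v) v) = 0" "\<exists>v\<in>f ` I. u v \<noteq> 0"
    using assms(2) by (auto simp: dependent_finite)
  then show ?thesis
    by (intro exI[of _ "u \<circ> f"]) (auto simp: sum.reindex[OF True])
next
  case False
  then obtain i j where ij: "i \<in> I" "j \<in> I" "i \<noteq> j" "f i = f j" by (auto simp: inj_on_def)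
  define k where "k l = (if l = i then 1 else if l = j then - 1 else (0 :: 'a))" for l
  have "(\<Sum>l\<in>I. scale (k l) (f l)) = (\<Sum>l\<in>{i, j}. scale (k l) (f l))"
    using ij assms(2) by (intro sum.mono_neutral_right) (auto simp: k_def)
  also have "\<dots> = 0" using ij by (simp add: k_def)
  finally show ?thesis using ij by (intro exI[of _ k]) (auto simp: k_def)
qed

lemma prod_diff_in_ideal_gen:
  assumes "\<And>j. j \<in> A \<Longrightarrow> f j - g j \<in> ideal_gen S"
  shows "prod f A - prod g A \<in> ideal_gen S"
  using assms
proof (induction A rule: infinite_finite_induct)
  case (insert j A)
  have "prod f (insert j A) - prod g (insert j A) = prod f A * (f j - g j) + g j * (prod f A - prod g A)"
    using insert by (simp add: algebra_simps)
  then show ?case using insert by (auto intro!: ideal_gen_add ideal_gen_mult)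
qed (simp_all add: ideal_gen_zero)

text \<open>
  The ideals \<open>J\<^sub>\<mu> = \<langle>S, u + \<mu> v\<rangle>\<close> are pairwise comaximal up to elements of \<open>A\<close>. As in
  the Chinese remainder theorem this yields elements \<open>e\<^sub>i\<close> that lie in \<open>J\<^sub>\<mu>\<close> for all but one of
  \<open>N + 1\<close> chosen parameters and are congruent to an element of \<open>A\<close> modulo the remaining one; a
  relation between them modulo \<open>S\<close> produces an element of \<open>A\<close> in some \<open>J\<^sub>\<mu>\<close>.
\<close>

lemma generic_combination:
  fixes S A M :: "'r::comm_ring_1 set" and N :: nat
  assumes A: "1 \<in> A" "\<And>a b. a \<in> A \<Longrightarrow> b \<in> A \<Longrightarrow> a * b \<in> A"
    and M: "infinite M" "\<And>\<mu> \<nu>. \<mu> \<in> M \<Longrightarrow> \<nu> \<in> M \<Longrightarrow> \<mu> \<noteq> \<nu> \<Longrightarrow> \<mu> - \<nu> \<in> A"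
    and rel: "\<And>e. \<exists>k. \<exists>i\<le>N. k i \<in> A \<and> (\<Sum>j\<le>N. k j * e j) \<in> ideal_gen S"
    and a: "a \<in> A" "a \<in> ideal_gen (insert u (insert v S))"
  shows "\<exists>\<mu>\<in>M. \<exists>b\<in>A. b \<in> ideal_gen (insert (u + \<mu> * v) S)"
proof -
  obtain m :: "nat \<Rightarrow> 'r" where m: "inj m" "range m \<subseteq> M"
    using infinite_countable_subset[OF M(1)] by blast
  have m_diff: "m i - m j \<in> A" if "i \<noteq> j" for i j
    using that m by (intro M(2)) (auto dest: injD)
  obtain \<alpha> \<beta> where ab: "a - \<alpha> * u - \<beta> * v \<in> ideal_gen S"
    using a(2) by (auto simp: ideal_gen_insert)
  define U where "U i = u + m i * v" for i
  define J where "J i = ideal_gen (insert (U i) S)" for i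
  have SJ: "x \<in> J i" if "x \<in> ideal_gen S" for x i
    unfolding J_def ideal_gen_insert using that by (intro exI[of _ 0]) simp
  have UJ: "x * U i \<in> J i" for x i
    unfolding J_def by (intro ideal_gen_mult ideal_gen_base) simp
  \<comment> \<open>\<open>F i j\<close> lies in \<open>J j\<close>. Modulo \<open>J i\<close> one
    has \<open>u = - m i * v\<close>, hence \<open>a = (\<beta> - \<alpha> * m i) * v\<close>, and
    so \<open>F i j\<close> is congruent to \<open>(m i - m j) * a\<close>, an element of
    \<open>A\<close>.\<close>
  define F where "F i j = (\<alpha> * m i - \<beta>) * U j" for i j
  define e where "e i = (\<Prod>j\<in>{..N} - {i}. F i j)" for i
  define P where "P i = (\<Prod>j\<in>{..N} - {i}. (m i - m j) * a)" for i
  have PA: "P i \<in> A" for i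
  proof -
    have "(\<Prod>j\<in>X. (m i - m j) * a) \<in> A" if "finite X" "i \<notin> X" for X
      using that by induction (auto intro!: A m_diff a)
    then show ?thesis unfolding P_def by simp
  qed
  have eP: "P i - e i \<in> J i" for i
    unfolding P_def e_def J_def
  proof (rule prod_diff_in_ideal_gen)
    fix j
    have "(m i - m j) * a - F i j = (m i - m j) * (a - \<alpha> * u - \<beta> * v) + (\<beta> - \<alpha> * m j) * U i"
      by (simp add: F_def U_def algebra_simps)
    then show "(m i - m j) * a - F i j \<in> ideal_gen (insert (U i) S)"
      using ideal_gen_add[OF SJ[OF ideal_gen_mult[OF ab], unfolded J_def] UJ[unfolded J_def]] by simp
  qed
  have eJ: "e j \<in> J i" if "i \<noteq> j" "i \<le> N" for i j
  proof -
    have "e j = (\<Prod>l\<in>{..N} - {j} - {i}. F j l) * (\<alpha> * m j - \<beta>) * U i"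
      unfolding e_def using that by (subst prod.remove[of _ i]) (auto simp: F_def mult_ac)
    then show ?thesis using UJ by simp
  qed
  obtain k i where k: "i \<le> N" "k i \<in> A" "(\<Sum>j\<le>N. k j * e j) \<in> ideal_gen S"
    using rel by blast
  \<comment> \<open>All terms of the relation except the \<open>i\<close>-th lie in
    \<open>J i\<close>, so \<open>k i * e i\<close> does too, and \<open>e i\<close> may be replaced
    by \<open>P i\<close>. The result is a product of elements of \<open>A\<close>.\<close>
  have "k i * P i = (\<Sum>j\<le>N. k j * e j) - (\<Sum>j\<in>{..N} - {i}. k j * e j) + k i * (P i - e i)"
    using k(1) by (subst sum.remove[of "{..N}" i]) (auto simp: algebra_simps)
  also have "\<dots> \<in> J i"
  proof -
    have "(\<Sum>j\<in>{..N} - {i}. k j * e j) \<in> J i"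
      unfolding J_def by (intro ideal_gen_sum ideal_gen_mult) (use eJ k(1) in \<open>auto simp: J_def\<close>)
    then show ?thesis
      using SJ[OF k(3)] ideal_gen_mult[OF eP[unfolded J_def]] unfolding J_def
      by (intro ideal_gen_add ideal_gen_diff)
  qed
  finally show ?thesis
    using A(2)[OF k(2) PA] m(2) unfolding J_def U_def by blast
qed

section \<open>Linear relations by counting dimensions over K\<close>

definition poly2_box :: "nat \<Rightarrow> nat \<Rightarrow> 'k::zero poly2 set" where
  "poly2_box n m = {f. \<forall>i j. n \<le> i \<or> m \<le> j \<longrightarrow> coeff (coeff f i) j = 0}"

lemma vector_space_poly2: "vector_space (\<lambda>(c :: 'k::field) (f :: 'k poly2). smult [:c:] f)"
proof unfold_locales
  fix a b :: 'k and x :: "'k poly2"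
  show "smult [:a + b:] x = smult [:a:] x + smult [:b:] x"
    by (simp flip: smult_add_left)
qed (simp_all add: smult_add_right mult.commute flip: one_pCons)

text \<open>Both bounds of the box are strict, so it is spanned over the field by
  \<open>n * m\<close> monomials, and any larger family in it is dependent.\<close>

lemma poly2_box_relation:
  fixes f :: "'i \<Rightarrow> 'k::field poly2"
  assumes "finite I" "n * m < card I" "\<And>i. i \<in> I \<Longrightarrow> f i \<in> poly2_box n m"
  shows "\<exists>k. (\<exists>i\<in>I. k i \<noteq> 0) \<and> (\<Sum>i\<in>I. smult [:k i:] (f i)) = 0"
proof (rule vector_space.exists_linear_relation[OF vector_space_poly2])
  interpret V: vector_space "\<lambda>(c :: 'k) (f :: 'k poly2). smult [:c:] f"
    by (rule vector_space_poly2)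
  define T where "T = (\<lambda>(i, j). monom (monom (1 :: 'k) j) i) ` ({..<n} \<times> {..<m})"
  show "finite T" by (simp add: T_def)
  have "card T \<le> n * m"
    unfolding T_def by (rule order_trans[OF card_image_le]) auto
  then show "card T < card I" using assms(2) by simp
  fix l assume "l \<in> I"
  then have box: "n \<le> i \<or> m \<le> j \<Longrightarrow> coeff (coeff (f l) i) j = 0" for i j
    using assms(3) by (auto simp: poly2_box_def)
  have "f l = (\<Sum>i<n. \<Sum>j<m. smult [:coeff (coeff (f l) i) j:] (monom (monom 1 j) i))"
  proof (intro poly_eqI)
    fix i' j'
    have "coeff (coeff (\<Sum>i<n. \<Sum>j<m. smult [:coeff (coeff (f l) i) j:] (monom (monom 1 j) i)) i') j'
        = (\<Sum>i<n. if i = i' then \<Sum>j<m. if j = j' then coeff (coeff (f l) i) j else 0 else 0)"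
      unfolding coeff_sum by (intro sum.cong refl) (simp add: smult_monom)
    also have "\<dots> = coeff (coeff (f l) i') j'"
      by (simp add: box not_less)
    finally show "coeff (coeff (f l) i') j' =
        coeff (coeff (\<Sum>i<n. \<Sum>j<m. smult [:coeff (coeff (f l) i) j:] (monom (monom 1 j) i)) i') j'" ..
  qed
  also have "\<dots> \<in> module.span (\<lambda>c. smult [:c:]) T"
    by (intro V.span_sum V.span_scale V.span_base) (auto simp: T_def)
  finally show "f l \<in> module.span (\<lambda>c. smult [:c:]) T" .
qed (rule assms)

subsection \<open>Polynomials that are monic in \<open>t\<close>\<close>

text \<open>The leading coefficient in \<open>t\<close> is a nonzero constant, and its exponent
  \<open>n\<close> is also the total degree. Division by \<open>x\<close> is therefore possible over
  \<open>K[s]\<close> without raising total degrees.\<close>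

locale monic_in_t =
  fixes x :: "'k::field poly2" and n l
  assumes lead: "coeff x n = [:l:]" "l \<noteq> 0" and deg: "total_degree x \<le> n"
begin

lemma coeff_above: "n < i \<Longrightarrow> coeff x i = 0"
  using degree_le_total_degree[of x] deg by (intro coeff_eq_0) linarith

text \<open>Induction on a bound for the degree in \<open>t\<close>. The multiplier \<open>T\<close>
  cancelling the top term has total degree at most \<open>D - n\<close>, so \<open>T * x\<close>
  stays within \<open>D\<close>.\<close>

lemma divide:
  "\<exists>q r. f = q * x + r \<and> (\<forall>i\<ge>n. coeff r i = 0) \<and>
     total_degree q \<le> total_degree f \<and> total_degree r \<le> total_degree f"
proof -
  have "\<exists>q r. f = q * x + r \<and> (\<forall>i\<ge>n. coeff r i = 0) \<and> total_degree q \<le> D \<and> total_degree r \<le> D"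
    if "\<forall>i\<ge>m. coeff f i = 0" "total_degree f \<le> D" for m D
    using that
  proof (induction m arbitrary: f)
    case 0
    then have "f = 0" by (intro poly_eqI) simp
    then show ?case by (intro exI[of _ 0]) simp
  next
    case (Suc m)
    show ?case
    proof (cases "n \<le> m \<and> coeff f m \<noteq> 0")
      case False
      then show ?thesis
      proof (cases "n \<le> m")
        case True
        then have "\<forall>i\<ge>m. coeff f i = 0" using False Suc(2) by (metis le_antisym not_less_eq_eq)
        then show ?thesis using Suc by blast
      next
        case False
        then show ?thesis using Suc by (intro exI[of _ 0] exI[of _ f]) auto
      qed
    next
      case True
      define T where "T = monom (smult (1 / l) (coeff f m)) (m - n)"
      have mD: "m \<le> D"
        using True Suc(3) total_degree_coeff_le[of f m "degree (coeff f m)"] by simp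
      have Tdeg: "total_degree T \<le> D - n"
        unfolding total_degree_le_iff
      proof (intro allI impI)
        fix i j assume "coeff (coeff T i) j \<noteq> 0"
        then have "i = m - n" "coeff (coeff f m) j \<noteq> 0"
          by (auto simp: T_def split: if_splits)
        then show "i + j \<le> D - n"
          using total_degree_coeff_le[of f m j] Suc(3) True by linarith
      qed
      have Txdeg: "total_degree (T * x) \<le> D"
        using total_degree_mult_le[OF Tdeg deg] mD True by simp
      have "\<forall>i\<ge>m. coeff (f - T * x) i = 0"
      proof (intro allI impI)
        fix i assume i: "m \<le> i"
        show "coeff (f - T * x) i = 0"
        proof (cases "i = m")
          case eq: True
          then show ?thesis
            using True lead by (simp add: T_def coeff_monom_mult)
        next
          case False
          then have "coeff x (i - (m - n)) = 0" using i True by (intro coeff_above) linarith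
          then show ?thesis using False i Suc(2) by (simp add: T_def coeff_monom_mult)
        qed
      qed
      then obtain q r where "f - T * x = q * x + r" "\<forall>i\<ge>n. coeff r i = 0"
        "total_degree q \<le> D" "total_degree r \<le> D"
        using Suc(1)[of "f - T * x"] total_degree_diff_le[OF Suc(3) Txdeg] by blast
      then show ?thesis
        using Tdeg by (intro exI[of _ "T + q"] exI[of _ r])
          (auto simp: algebra_simps intro!: total_degree_add_le)
    qed
  qed
  from this[of "Suc (degree f)"] show ?thesis by (simp add: coeff_eq_0 Suc_le_eq)
qed

text \<open>A nonzero multiple of \<open>x\<close> has degree at least \<open>n\<close> in
  \<open>t\<close>. This is the uniqueness of remainders.\<close>

lemma reduced_multiple_eq_0:
  assumes "f = q * x" "\<forall>i\<ge>n. coeff f i = 0"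
  shows "f = 0"
proof (rule ccontr)
  assume "f \<noteq> 0"
  then have "q * x \<noteq> 0" using assms(1) by simp
  then have "q \<noteq> 0" by auto
  have x: "degree x = n"
    using lead degree_le_total_degree[of x] deg le_degree[of x n] by force
  have "degree (q * x) = degree q + n"
    using \<open>q * x \<noteq> 0\<close> x by (simp add: degree_mult_eq)
  then have "coeff (q * x) (degree (q * x)) = 0" using assms by simp
  then show False using \<open>q * x \<noteq> 0\<close> by simp
qed

lemma mem_ideal: "f \<in> ideal_gen {x} \<longleftrightarrow> (\<exists>q. f = q * x)"
  by (auto simp: ideal_gen_insert ideal_gen_empty)

text \<open>The remainders of the \<open>e i\<close> modulo \<open>x\<close> are multiplied by all
  \<open>s^j\<close> with \<open>j \<le> n * C\<close>. A relation over the field among these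
  products, grouped by \<open>i\<close>, is a relation over \<open>K[s]\<close> with coefficients of
  bounded degree.\<close>

lemma exists_relation_mod:
  assumes e: "\<And>i. i \<le> n \<Longrightarrow> total_degree (e i) \<le> C"
  shows "\<exists>k. (\<exists>i\<le>n. k i \<noteq> 0) \<and> (\<forall>i. degree (k i) \<le> n * C) \<and>
    (\<Sum>i\<le>n. [:k i:] * e i) \<in> ideal_gen {x}"
proof -
  define N where "N = n * C"
  have "\<forall>i. \<exists>q r. e i = q * x + r \<and> (\<forall>j\<ge>n. coeff r j = 0) \<and> (i \<le> n \<longrightarrow> total_degree r \<le> C)"
    using divide e by (meson order_trans)
  then obtain q r where r: "\<And>i. e i = q i * x + r i" "\<And>i j. n \<le> j \<Longrightarrow> coeff (r i) j = 0"
    "\<And>i. i \<le> n \<Longrightarrow> total_degree (r i) \<le> C"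
    by metis
  define f where "f = (\<lambda>(i, j). smult (monom (1 :: 'k) j) (r i))"
  have "\<exists>\<kappa>. (\<exists>p\<in>{..n} \<times> {..N}. \<kappa> p \<noteq> 0) \<and> (\<Sum>p\<in>{..n} \<times> {..N}. smult [:\<kappa> p:] (f p)) = 0"
  proof (rule poly2_box_relation[where n = n and m = "N + C + 1"])
    \<comment> \<open>With \<open>N = n * C\<close> the number \<open>(n + 1) * (N + 1)\<close> of
      products exceeds the dimension of the box by exactly one.\<close>
    show "n * (N + C + 1) < card ({..n} \<times> {..N})"
      by (simp add: N_def algebra_simps)
    fix p assume "p \<in> {..n} \<times> {..N}"
    then obtain i j where p: "p = (i, j)" "i \<le> n" "j \<le> N" by auto
    have "coeff (coeff (r i) i') j' = 0" if "j' > C" for i' j'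
      using total_degree_coeff_le[of "r i" i' j'] r(3)[OF p(2)] that by force
    then show "f p \<in> poly2_box n (N + C + 1)"
      using p r(2) by (auto simp: f_def poly2_box_def coeff_monom_mult)
  qed simp
  then obtain \<kappa> i0 j0 where \<kappa>: "i0 \<le> n" "j0 \<le> N" "\<kappa> (i0, j0) \<noteq> 0"
    "(\<Sum>p\<in>{..n} \<times> {..N}. smult [:\<kappa> p:] (f p)) = 0"
    by auto
  define k where "k i = (\<Sum>j\<le>N. monom (\<kappa> (i, j)) j)" for i
  have "coeff (k i0) j0 \<noteq> 0"
    using \<kappa> by (simp add: k_def coeff_sum)
  then have "k i0 \<noteq> 0" by auto
  moreover have "degree (k i) \<le> N" for i
    unfolding k_def by (intro degree_sum_le) (auto intro: order_trans[OF degree_monom_le])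
  moreover have "(\<Sum>i\<le>n. [:k i:] * e i) \<in> ideal_gen {x}"
  proof -
    have "(\<Sum>i\<le>n. [:k i:] * r i) = (\<Sum>i\<le>n. \<Sum>j\<le>N. smult [:\<kappa> (i, j):] (f (i, j)))"
      by (intro sum.cong refl) (simp add: k_def f_def smult_sum smult_monom)
    also have "\<dots> = 0" using \<kappa>(4) by (simp add: sum.cartesian_product)
    finally have "(\<Sum>i\<le>n. [:k i:] * e i) = (\<Sum>i\<le>n. [:k i:] * q i) * x"
      unfolding r(1) by (simp add: distrib_left sum.distrib sum_distrib_right mult.assoc del: mult_pCons_left)
    then show ?thesis by (auto simp: mem_ideal)
  qed
  ultimately show ?thesis using \<kappa>(1) unfolding N_def by blast
qed

text \<open>Division with remainder supplies a quotient of bounded degree; by uniqueness its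
  remainder is zero.\<close>

lemma divide_exact:
  assumes "f \<in> ideal_gen {x}"
  shows "\<exists>q. f = q * x \<and> total_degree q \<le> total_degree f"
proof -
  obtain p where p: "f = p * x" using assms mem_ideal by blast
  obtain q r where q: "f = q * x + r" "\<forall>i\<ge>n. coeff r i = 0" "total_degree q \<le> total_degree f"
    using divide by blast
  have "r = (p - q) * x" using p q(1) by (simp add: algebra_simps)
  then have "r = 0" using q(2) reduced_multiple_eq_0 by blast
  then show ?thesis using q by auto
qed

text \<open>\<open>generic_combination\<close> is applied with the nonzero elements of
  \<open>K[s]\<close> as \<open>A\<close>. Modulo \<open>x\<close> any \<open>n + 1\<close>
  polynomials are dependent over \<open>K[s]\<close>.\<close>

lemma exists_elimination_combination:
  assumes "infinite (UNIV :: 'k set)" "x \<in> S"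
    and g: "g \<noteq> 0" "[:g:] \<in> ideal_gen (insert u (insert v S))"
  shows "\<exists>\<mu> h. h \<noteq> 0 \<and> [:h:] \<in> ideal_gen (insert (u + [:[:\<mu>:]:] * v) S)"
proof -
  have "\<exists>\<mu>\<in>range (\<lambda>c. [:[:c:]:]). \<exists>b\<in>{[:h:] | h. h \<noteq> 0}. b \<in> ideal_gen (insert (u + \<mu> * v) S)"
  proof (rule generic_combination)
    show "infinite (range (\<lambda>c :: 'k. [:[:c:]:]))"
      using assms(1) by (simp add: finite_image_iff inj_on_def)
    show "[:g:] \<in> {[:h:] | h. h \<noteq> 0}" using g(1) by blast
    fix e :: "nat \<Rightarrow> 'k poly2"
    have "total_degree (e i) \<le> (\<Sum>j\<le>n. total_degree (e j))" if "i \<le> n" for i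
      using that by (intro member_le_sum) auto
    then obtain k i where k: "i \<le> n" "k i \<noteq> 0" "(\<Sum>i\<le>n. [:k i:] * e i) \<in> ideal_gen {x}"
      using exists_relation_mod by blast
    have "ideal_gen {x} \<subseteq> ideal_gen S" using assms(2) by (intro ideal_gen_mono) simp
    then show "\<exists>k. \<exists>i\<le>n. k i \<in> {[:h:] | h. h \<noteq> 0} \<and> (\<Sum>j\<le>n. k j * e j) \<in> ideal_gen S"
      using k by (intro exI[of _ "\<lambda>i. [:k i:]"]) blast
  qed (use g(2) in \<open>auto simp: one_pCons\<close>)
  then show ?thesis by blast
qed

text \<open>Division by \<open>x\<close> bounds the degree in \<open>t\<close>; reducing each
  coefficient modulo \<open>\<rho>\<close> then bounds the degree in \<open>s\<close>.\<close>

lemma reduce_mod: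
  assumes "\<rho> \<noteq> 0"
  shows "\<exists>r. f - r \<in> ideal_gen {x, [:\<rho>:]} \<and> r \<in> poly2_box n (degree \<rho>)"
proof -
  obtain q r where q: "f = q * x + r" "\<forall>i\<ge>n. coeff r i = 0"
    using divide by blast
  define r' where "r' = map_poly (\<lambda>g. g mod \<rho>) r"
  define Q where "Q = map_poly (\<lambda>g. g div \<rho>) r"
  have r: "r = r' + Q * [:\<rho>:]"
    by (rule poly_eqI) (simp add: r'_def Q_def coeff_map_poly mult.commute[of \<rho>])
  have "f - r' = q * x + Q * [:\<rho>:]" using q(1) r by simp
  moreover have "\<dots> \<in> ideal_gen {x, [:\<rho>:]}"
    by (intro ideal_gen_add ideal_gen_mult ideal_gen_base) auto
  ultimately have "f - r' \<in> ideal_gen {x, [:\<rho>:]}" by (simp only:)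
  moreover have "coeff (g mod \<rho>) j = 0" if "degree \<rho> \<le> j" for g j
    using degree_mod_less[OF assms, of g] that by (metis coeff_0 coeff_eq_0 less_le_trans)
  then have "r' \<in> poly2_box n (degree \<rho>)"
    using q(2) by (auto simp: poly2_box_def r'_def coeff_map_poly)
  ultimately show ?thesis by blast
qed

text \<open>\<open>generic_combination\<close> is applied with the nonzero constants as
  \<open>A\<close>. The quotient by \<open>x\<close> and \<open>\<rho>\<close> has dimension at most
  \<open>n * degree \<rho>\<close> over the field, so one more element forces a relation. A nonzero
  constant in the ideal is finally scaled to \<open>1\<close>.\<close>

lemma exists_unit_combination:
  assumes "infinite (UNIV :: 'k set)" "\<rho> \<noteq> 0" "{x, [:\<rho>:]} \<subseteq> S"
    and "1 \<in> ideal_gen (insert u (insert v S))"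
  shows "\<exists>\<mu>. 1 \<in> ideal_gen (insert (u + [:[:\<mu>:]:] * v) S)"
proof -
  define N where "N = n * degree \<rho>"
  have "\<exists>\<mu>\<in>range (\<lambda>c. [:[:c:]:]). \<exists>b\<in>{[:[:c:]:] | c. c \<noteq> 0}. b \<in> ideal_gen (insert (u + \<mu> * v) S)"
  proof (rule generic_combination)
    show "infinite (range (\<lambda>c :: 'k. [:[:c:]:]))"
      using assms(1) by (simp add: finite_image_iff inj_on_def)
    show "(1 :: 'k poly2) \<in> {[:[:c:]:] | c. c \<noteq> 0}" by (auto simp: one_pCons)
    fix e :: "nat \<Rightarrow> 'k poly2"
    have "\<forall>i. \<exists>r. e i - r \<in> ideal_gen {x, [:\<rho>:]} \<and> r \<in> poly2_box n (degree \<rho>)"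
      using reduce_mod[OF assms(2)] by blast
    then obtain r where r: "\<And>i. e i - r i \<in> ideal_gen {x, [:\<rho>:]}"
      "\<And>i. r i \<in> poly2_box n (degree \<rho>)"
      by metis
    have "\<exists>k. (\<exists>i\<in>{..N}. k i \<noteq> 0) \<and> (\<Sum>i\<le>N. smult [:k i:] (r i)) = 0"
      using r(2) by (intro poly2_box_relation) (auto simp: N_def)
    then obtain k i where k: "i \<le> N" "k i \<noteq> 0" "(\<Sum>i\<le>N. smult [:k i:] (r i)) = 0" by auto
    have "(\<Sum>i\<le>N. [:[:k i:]:] * e i) = (\<Sum>i\<le>N. [:[:k i:]:] * (e i - r i))"
      using k(3) by (simp add: smult_diff_right sum_subtractf)
    also have "\<dots> \<in> ideal_gen S"
      using ideal_gen_mono[OF assms(3)] r(1) by (intro ideal_gen_sum ideal_gen_mult) blast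
    finally show "\<exists>k. \<exists>i\<le>N. k i \<in> {[:[:c:]:] | c. c \<noteq> 0} \<and> (\<Sum>j\<le>N. k j * e j) \<in> ideal_gen S"
      using k by (intro exI[of _ "\<lambda>i. [:[:k i:]:]"]) blast
  qed (use assms(4) in \<open>auto simp: one_pCons\<close>)
  then obtain \<mu> c where c: "c \<noteq> 0" "[:[:c:]:] \<in> ideal_gen (insert (u + [:[:\<mu>:]:] * v) S)"
    by blast
  have "[:[:1 / c:]:] * [:[:c:]:] \<in> ideal_gen (insert (u + [:[:\<mu>:]:] * v) S)"
    using c(2) by (rule ideal_gen_mult)
  then show ?thesis using c(1) by (auto simp: one_pCons)
qed

text \<open>A relation over \<open>K[s]\<close> modulo \<open>x\<close> among
  \<open>1, y, t y, ..., t^(n-1) y\<close> puts \<open>[:k 0:] + B * y\<close> into the ideal of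
  \<open>x\<close>. Some nonzero element of \<open>K[s]\<close> in the ideal of \<open>x\<close> and
  \<open>y\<close>, of whatever degree, ensures \<open>k 0 \<noteq> 0\<close>.\<close>

lemma bounded_elimination:
  assumes n: "n \<le> d" and y: "total_degree y \<le> d"
    and g: "g \<noteq> 0" "[:g:] \<in> ideal_gen {y, x}"
  shows "\<exists>\<rho> A B. \<rho> \<noteq> 0 \<and> [:\<rho>:] = A * x + B * y \<and> degree \<rho> \<le> 2 * d\<^sup>2 \<and>
    total_degree A \<le> 2 * d\<^sup>2 + 2 * d \<and> total_degree B \<le> 2 * d\<^sup>2 + d"
proof -
  define e where "e i = (case i of 0 \<Rightarrow> 1 | Suc j \<Rightarrow> monom 1 j * y)" for i
  have mono: "total_degree (monom (1 :: 'k poly) j) \<le> j" for j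
    using total_degree_monom_monom_le[of "1 :: 'k" 0 j] by (simp add: monom_0 one_pCons)
  have "total_degree (e i) \<le> 2 * d" if "i \<le> n" for i
  proof (cases i)
    case (Suc j)
    have "total_degree (monom 1 j * y) \<le> j + d"
      by (intro total_degree_mult_le mono y)
    then show ?thesis using Suc that n by (simp add: e_def)
  qed (simp add: e_def)
  then obtain k where k: "\<exists>i\<le>n. k i \<noteq> 0" "\<And>i. degree (k i) \<le> n * (2 * d)"
    "(\<Sum>i\<le>n. [:k i:] * e i) \<in> ideal_gen {x}"
    using exists_relation_mod by blast
  have kdeg: "degree (k i) \<le> 2 * d\<^sup>2" for i
    using order_trans[OF k(2) mult_le_mono1[OF n]] by (simp add: power2_eq_square mult.left_commute)
  define B where "B = (\<Sum>i<n. monom (k (Suc i)) i)"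
  have sum: "(\<Sum>i\<le>n. [:k i:] * e i) = [:k 0:] + B * y"
    unfolding B_def sum_distrib_right
    by (subst sum.atMost_shift) (simp add: e_def smult_monom flip: mult_smult_left)
  have cB: "coeff B i = (if i < n then k (Suc i) else 0)" for i
    by (simp add: B_def coeff_sum)
  have "k 0 \<noteq> 0"
  \<comment> \<open>If \<open>k 0 = 0\<close>, then \<open>x\<close> divides \<open>B * y\<close>.
    As \<open>y\<close> is invertible modulo \<open>x\<close> up to the factor \<open>g\<close>, it
    also divides \<open>[:g:] * B\<close>, which has degree below \<open>n\<close> in
    \<open>t\<close>. So \<open>B = 0\<close> and all coefficients of the relation vanish.\<close>
  proof
    assume k0: "k 0 = 0"
    obtain q where q: "B * y = q * x" using k(3) k0 unfolding sum by (auto simp: mem_ideal)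
    obtain p where "[:g:] - p * y \<in> ideal_gen {x}"
      using g(2) by (auto simp: ideal_gen_insert[of _ y])
    then obtain p' where "[:g:] = p * y + p' * x" by (auto simp: mem_ideal algebra_simps)
    then have "[:g:] * B = p * (B * y) + p' * B * x" by (simp add: algebra_simps)
    then have "[:g:] * B = (p * q + p' * B) * x" unfolding q by (simp add: algebra_simps)
    then have "[:g:] * B = 0"
      by (rule reduced_multiple_eq_0) (simp add: cB)
    then have "B = 0" using g(1) by simp
    then have "k (Suc i) = 0" if "i < n" for i using cB[of i] that by simp
    then have "k i = 0" if "i \<le> n" for i using k0 that by (cases i) auto
    then show False using k(1) by blast
  qed
  have Bdeg: "total_degree B \<le> 2 * d\<^sup>2 + d"
    unfolding total_degree_le_iff
  proof (intro allI impI)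
    fix i j assume "coeff (coeff B i) j \<noteq> 0"
    then have "i < n" "j \<le> degree (k (Suc i))" by (auto simp: cB le_degree split: if_splits)
    then show "i + j \<le> 2 * d\<^sup>2 + d" using kdeg[of "Suc i"] n by linarith
  qed
  obtain A where A: "[:k 0:] + B * y = A * x" "total_degree A \<le> total_degree ([:k 0:] + B * y)"
    using divide_exact k(3) by (metis sum)
  have "total_degree ([:k 0:] + B * y) \<le> 2 * d\<^sup>2 + 2 * d"
    using order_trans[OF total_degree_const kdeg[of 0]] total_degree_mult_le[OF Bdeg y]
    by (intro total_degree_add_le) auto
  moreover have "[:k 0:] = A * x + (- B) * y" using A(1) by (simp add: algebra_simps)
  ultimately show ?thesis
    using \<open>k 0 \<noteq> 0\<close> kdeg[of 0] A(2) Bdeg by (intro exI[of _ "k 0"] exI[of _ A] exI[of _ "- B"]) simp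
qed

text \<open>An inverse of \<open>z\<close> modulo \<open>x\<close> and \<open>\<rho>\<close> can be
  chosen reduced, which bounds its degree. Division of \<open>1 - c * z\<close> by \<open>x\<close>
  bounds the second coefficient, and the remainder turns out to be a multiple of
  \<open>\<rho>\<close>.\<close>

lemma bounded_bezout:
  assumes "\<rho> \<noteq> 0" "degree \<rho> \<le> N" and z: "total_degree z \<le> d"
    and one: "1 \<in> ideal_gen {z, x, [:\<rho>:]}"
  shows "\<exists>c A b. 1 = c * z + A * x + b * [:\<rho>:] \<and>
    total_degree c \<le> n + N + d \<and> total_degree A \<le> n + N + d \<and> total_degree b \<le> n + N + d"
proof -
  obtain c' where c': "1 - c' * z \<in> ideal_gen {x, [:\<rho>:]}"
    using one by (auto simp: ideal_gen_insert[of _ z])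
  obtain c where c: "c' - c \<in> ideal_gen {x, [:\<rho>:]}" "c \<in> poly2_box n (degree \<rho>)"
    using reduce_mod[OF assms(1)] by blast
  have cdeg: "total_degree c \<le> n + N"
    unfolding total_degree_le_iff
  proof (intro allI impI)
    fix i j assume "coeff (coeff c i) j \<noteq> 0"
    then have "i < n" "j < degree \<rho>" using c(2) by (auto simp: poly2_box_def not_le[symmetric])
    then show "i + j \<le> n + N" using assms(2) by linarith
  qed
  define F where "F = 1 - c * z"
  have Fdeg: "total_degree F \<le> n + N + d"
    unfolding F_def using total_degree_mult_le[OF cdeg z] by (intro total_degree_diff_le) auto
  have "F = (1 - c' * z) + z * (c' - c)" by (simp add: F_def algebra_simps)
  then have "F \<in> ideal_gen {x, [:\<rho>:]}"
    using c' c(1) by (auto intro!: ideal_gen_add ideal_gen_mult)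
  then obtain k p where kp: "F = k * x + p * [:\<rho>:]"
    by (auto simp: ideal_gen_insert ideal_gen_empty algebra_simps)
  obtain q r where q: "F = q * x + r" "\<forall>i\<ge>n. coeff r i = 0"
    "total_degree q \<le> total_degree F" "total_degree r \<le> total_degree F"
    using divide by blast
  \<comment> \<open>The cofactor of \<open>\<rho>\<close> is reduced modulo \<open>x\<close> as
    well. Then \<open>r - b * [:\<rho>:]\<close> is a multiple of \<open>x\<close> of degree below
    \<open>n\<close> in \<open>t\<close>, hence zero.\<close>
  obtain p' b where b: "p = p' * x + b" "\<forall>i\<ge>n. coeff b i = 0"
    using divide by blast
  have "r - b * [:\<rho>:] = (k + p' * [:\<rho>:] - q) * x"
  proof -
    have "r = F - q * x" using q(1) by simp
    also have "\<dots> = k * x + (p' * x + b) * [:\<rho>:] - q * x" unfolding kp b(1) ..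
    finally show ?thesis by (simp only: algebra_simps)
  qed
  then have "r - b * [:\<rho>:] = 0"
    by (rule reduced_multiple_eq_0) (simp add: q(2) b(2))
  then have r: "r = b * [:\<rho>:]" by simp
  have "total_degree b \<le> n + N + d"
    using total_degree_le_mult_const[OF assms(1), of b] q(4) Fdeg unfolding r by linarith
  moreover have "1 = c * z + q * x + b * [:\<rho>:]"
    using q(1) r unfolding F_def by (simp only: diff_eq_eq) (simp only: algebra_simps)
  ultimately show ?thesis
    using cdeg q(3) Fdeg by (intro exI[of _ c] exI[of _ q] exI[of _ b]) auto
qed

text \<open>\<open>y\<close> is chosen so that the ideal of \<open>x\<close> and \<open>y\<close>
  contains some \<open>\<rho> \<noteq> 0\<close> from \<open>K[s]\<close>, and \<open>z\<close> so
  that it is a unit modulo \<open>x\<close> and \<open>\<rho>\<close>. Inserting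
  \<open>[:\<rho>:] = A * x + B * y\<close> into the identity for \<open>z\<close> costs at most
  \<open>n + 2 * d\<^sup>2 + d\<close> plus \<open>2 * d\<^sup>2 + 2 * d\<close> in degree.\<close>

lemma bounded_unit_combination:
  assumes inf: "infinite (UNIV :: 'k set)" and n: "n \<le> d"
    and deg: "total_degree c\<^sub>2 \<le> d" "total_degree c\<^sub>3 \<le> d" "total_degree c\<^sub>4 \<le> d"
    and one: "1 \<in> ideal_gen {c\<^sub>3, c\<^sub>4, c\<^sub>2, x}"
  shows "\<exists>\<theta> \<mu> \<nu> \<kappa> h\<^sub>1 h\<^sub>2 h\<^sub>3. \<forall>y z. y = c\<^sub>2 + [:[:\<theta>:]:] * c\<^sub>3 + [:[:\<mu>:]:] * c\<^sub>4 \<longrightarrow>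
      z = c\<^sub>3 + [:[:\<nu>:]:] * c\<^sub>4 + [:[:\<kappa>:]:] * y \<longrightarrow>
      1 = h\<^sub>1 * x + h\<^sub>2 * y + h\<^sub>3 * z \<and> total_degree h\<^sub>1 \<le> 4 * d\<^sup>2 + 4 * d \<and>
      total_degree h\<^sub>2 \<le> 4 * d\<^sup>2 + 4 * d \<and> total_degree h\<^sub>3 \<le> 4 * d\<^sup>2 + 4 * d"
proof -
  have const: "total_degree ([:[:c:]:] * f) \<le> d" if "total_degree f \<le> d" for c :: 'k and f
    using total_degree_mult_le[OF total_degree_const that, of "[:c:]"] by simp
  \<comment> \<open>Each application merges two generators into one: first the third and fourth
    entries, starting from the element \<open>1\<close> of the ideal, then the second with the
    result.\<close>
  have "\<exists>\<mu> h. h \<noteq> 0 \<and> [:h:] \<in> ideal_gen (insert (c\<^sub>3 + [:[:\<mu>:]:] * c\<^sub>4) {c\<^sub>2, x})"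
    by (rule exists_elimination_combination[OF inf, where g = 1]) (use one in \<open>auto simp: one_pCons\<close>)
  then obtain \<mu> h where h: "h \<noteq> 0" "[:h:] \<in> ideal_gen {c\<^sub>2, c\<^sub>3 + [:[:\<mu>:]:] * c\<^sub>4, x}"
    by (auto simp: insert_commute)
  then obtain \<theta> g where g: "g \<noteq> 0"
    "[:g:] \<in> ideal_gen {c\<^sub>2 + [:[:\<theta>:]:] * (c\<^sub>3 + [:[:\<mu>:]:] * c\<^sub>4), x}"
    using exists_elimination_combination[OF inf, of "{x}"] by blast
  define y where "y = c\<^sub>2 + [:[:\<theta>:]:] * c\<^sub>3 + [:[:\<theta> * \<mu>:]:] * c\<^sub>4"
  have y: "c\<^sub>2 + [:[:\<theta>:]:] * (c\<^sub>3 + [:[:\<mu>:]:] * c\<^sub>4) = y"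
    by (simp add: y_def smult_add_right mult.commute)
  have ydeg: "total_degree y \<le> d"
    unfolding y_def by (intro total_degree_add_le const deg)
  obtain \<rho> A B where \<rho>: "\<rho> \<noteq> 0" "[:\<rho>:] = A * x + B * y" "degree \<rho> \<le> 2 * d\<^sup>2"
    "total_degree A \<le> 2 * d\<^sup>2 + 2 * d" "total_degree B \<le> 2 * d\<^sup>2 + d"
    using bounded_elimination[OF n ydeg g(1)] g(2) unfolding y by blast
  have "1 \<in> ideal_gen {c\<^sub>3, c\<^sub>4, y, x, [:\<rho>:]}"
  proof -
    have "c\<^sub>2 = y - [:[:\<theta>:]:] * c\<^sub>3 - [:[:\<theta> * \<mu>:]:] * c\<^sub>4" by (simp add: y_def)
    also have "\<dots> \<in> ideal_gen {c\<^sub>3, c\<^sub>4, y, x, [:\<rho>:]}"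
      by (intro ideal_gen_diff ideal_gen_mult ideal_gen_base) auto
    finally have "ideal_gen {c\<^sub>3, c\<^sub>4, c\<^sub>2, x} \<subseteq> ideal_gen {c\<^sub>3, c\<^sub>4, y, x, [:\<rho>:]}"
      by (intro ideal_gen_minimal) (auto intro: ideal_gen_base)
    then show ?thesis using one by blast
  qed
  then obtain \<nu> where "1 \<in> ideal_gen {c\<^sub>3 + [:[:\<nu>:]:] * c\<^sub>4, y, x, [:\<rho>:]}"
    using exists_unit_combination[OF inf \<rho>(1), of "{y, x, [:\<rho>:]}"] by auto
  \<comment> \<open>\<open>y\<close> is absorbed into \<open>z\<close>, so that only
    \<open>z\<close>, \<open>x\<close> and \<open>\<rho>\<close> remain as generators.\<close>
  then obtain \<kappa> where \<kappa>: "1 \<in> ideal_gen {c\<^sub>3 + [:[:\<nu>:]:] * c\<^sub>4 + [:[:\<kappa>:]:] * y, x, [:\<rho>:]}"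
    using exists_unit_combination[OF inf \<rho>(1), of "{x, [:\<rho>:]}"] by blast
  define z where "z = c\<^sub>3 + [:[:\<nu>:]:] * c\<^sub>4 + [:[:\<kappa>:]:] * y"
  have zdeg: "total_degree z \<le> d"
    unfolding z_def by (intro total_degree_add_le const deg ydeg)
  obtain c A' b where c: "1 = c * z + A' * x + b * [:\<rho>:]" "total_degree c \<le> n + 2 * d\<^sup>2 + d"
    "total_degree A' \<le> n + 2 * d\<^sup>2 + d" "total_degree b \<le> n + 2 * d\<^sup>2 + d"
    using bounded_bezout[OF \<rho>(1,3) zdeg] \<kappa> unfolding z_def by blast
  have "1 = (A' + b * A) * x + (b * B) * y + c * z"
    using c(1) unfolding \<rho>(2) by (simp add: algebra_simps)
  moreover have "total_degree (A' + b * A) \<le> 4 * d\<^sup>2 + 4 * d"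
    using total_degree_mult_le[OF c(4) \<rho>(4)] c(3) n by (intro total_degree_add_le) auto
  moreover have "total_degree (b * B) \<le> 4 * d\<^sup>2 + 4 * d"
    using total_degree_mult_le[OF c(4) \<rho>(5)] n by auto
  moreover have "total_degree c \<le> 4 * d\<^sup>2 + 4 * d" using c(2) n by auto
  ultimately show ?thesis unfolding z_def y_def by blast
qed

end

subsection \<open>Unimodular rows\<close>

lemma distinct_4: "(1::4) \<noteq> 2" "(1::4) \<noteq> 3" "(1::4) \<noteq> 4" "(2::4) \<noteq> 3" "(2::4) \<noteq> 4" "(3::4) \<noteq> 4"
  by simp_all

lemma coeff_linear_power:
  "coeff ([:a, b:] ^ j) m = 0" if "j < m" for a b :: "'a::comm_semiring_1"
  by (rule coeff_eq_0, rule le_less_trans[OF degree_power_le])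
    (use that in \<open>auto simp: degree_pCons_eq_if\<close>)

lemma coeff_linear_power_top: "coeff ([:a, b:] ^ j) j = (b :: 'a::comm_semiring_1) ^ j"
proof (induction j)
  case (Suc j)
  have "coeff ([:a, b:] ^ Suc j) (Suc j) = a * coeff ([:a, b:] ^ j) (Suc j) + b * coeff ([:a, b:] ^ j) j"
    by simp
  then show ?case using Suc by (simp add: coeff_linear_power)
qed simp

text \<open>After replacing \<open>s\<close> by \<open>s + c t\<close>, the coefficient of
  \<open>t^n\<close> is the constant \<open>poly P c\<close>, where \<open>P\<close> is the top
  homogeneous part of \<open>f\<close> with \<open>t\<close> set to \<open>1\<close>. It is nonzero,
  and an infinite field contains a \<open>c\<close> that is not a root.\<close>

lemma exists_monic_substitution:
  fixes f :: "'k::field poly2"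
  assumes "infinite (UNIV :: 'k set)" "f \<noteq> 0"
  shows "\<exists>c l. monic_in_t (subst2 [:[:0, 1:], [:c:]:] var_t f) (total_degree f) l"
proof -
  define n where "n = total_degree f"
  define P where "P = (\<Sum>j\<le>n. monom (coeff (coeff f (n - j)) j) j)"
  obtain i j where ij: "coeff (coeff f i) j \<noteq> 0" "i + j = n"
    using exists_coeff_total_degree[OF assms(2)] unfolding n_def by blast
  have "coeff P j = coeff (coeff f i) j"
    using ij(2) by (auto simp: P_def coeff_sum)
  then have "P \<noteq> 0" using ij by auto
  then have "finite {c. poly P c = 0}" by (rule poly_roots_finite)
  then obtain c where c: "poly P c \<noteq> 0"
    using assms(1) by (metis (mono_tags, lifting) UNIV_eq_I mem_Collect_eq)
  define X :: "'k poly2" where "X = [:[:0, 1:], [:c:]:]"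
  have X: "total_degree X \<le> 1"
    by (auto simp: X_def total_degree_le_iff coeff_pCons split: nat.splits)
  have "coeff (subst2 X var_t f) n = [:poly P c:]"
  proof -
    have summand: "coeff ([:[:coeff (coeff f i) j:]:] * X ^ j * var_t ^ i) n =
        (if i = n - j then [:coeff (coeff f (n - j)) j * c ^ j:] else 0)" if "i \<le> n" "j \<le> n" for i j
    proof (cases "coeff (coeff f i) j = 0")
      case False
      then have le: "i + j \<le> n" using total_degree_coeff_le n_def by blast
      have "coeff ([:[:coeff (coeff f i) j:]:] * X ^ j * var_t ^ i) n
          = [:coeff (coeff f i) j:] * coeff (X ^ j) (n - i)"
      proof -
        have "[:[:coeff (coeff f i) j:]:] * X ^ j * var_t ^ i = monom [:coeff (coeff f i) j:] i * X ^ j"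
          by (simp add: monom_altdef mult.commute)
        then show ?thesis using that(1) by (simp add: coeff_monom_mult)
      qed
      also have "\<dots> = (if i = n - j then [:coeff (coeff f (n - j)) j * c ^ j:] else 0)"
      proof (cases "i = n - j")
        case True
        then show ?thesis
          using that by (simp add: X_def coeff_linear_power_top poly_const_pow)
      next
        case False
        then have "j < n - i" using le by linarith
        then show ?thesis using False by (simp add: X_def coeff_linear_power)
      qed
      finally show ?thesis .
    qed auto
    have "coeff (subst2 X var_t f) n =
        (\<Sum>i\<le>n. \<Sum>j\<le>n. if i = n - j then [:coeff (coeff f (n - j)) j * c ^ j:] else 0)"
      unfolding subst2_altdef n_def[symmetric] coeff_sum by (intro sum.cong refl summand) auto
    also have "\<dots> = (\<Sum>j\<le>n. \<Sum>i\<le>n. if i = n - j then [:coeff (coeff f (n - j)) j * c ^ j:] else 0)"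
      by (rule sum.swap)
    also have "\<dots> = (\<Sum>j\<le>n. [:coeff (coeff f (n - j)) j * c ^ j:])"
      by (intro sum.cong refl) simp
    also have "\<dots> = [:poly P c:]"
      by (rule poly_eqI) (simp add: P_def poly_sum poly_monom coeff_sum coeff_pCons split: nat.splits)
    finally show ?thesis .
  qed
  moreover have "total_degree (subst2 X var_t f) \<le> n"
    using total_degree_subst2_le[OF X total_degree_var_t_le, of f] by (simp add: n_def)
  ultimately have "monic_in_t (subst2 X var_t f) n (poly P c)"
    using c by unfold_locales auto
  then show ?thesis unfolding X_def n_def by blast
qed

text \<open>\<open>y\<close> is put in place 2, \<open>z\<close> in place 3 and finally
  \<open>1\<close> in place 4. The first two operations have constant coefficients and cost nothing;
  the last costs \<open>d + (4 * d\<^sup>2 + 4 * d)\<close>, on top of the basis of degree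
  \<open>d\<close> for a row with entry \<open>1\<close>.\<close>

lemma (in monic_in_t) syz_basis_le_unimodular_monic:
  fixes c :: "'k poly2 ^ 4"
  assumes inf: "infinite (UNIV :: 'k set)" and n: "n \<le> d" and x: "c $ 1 = x"
    and deg: "\<And>i. total_degree (c $ i) \<le> d" and one: "1 \<in> ideal_gen (range (($) c))"
  shows "syz_basis_le c (4 * d\<^sup>2 + 6 * d)"
proof -
  note ne = distinct_4 distinct_4[symmetric]
  have "range (($) c) = {c $ 3, c $ 4, c $ 2, x}"
    unfolding x[symmetric] UNIV_4 by auto
  then obtain \<theta> \<mu> \<nu> \<kappa> h1 h2 h3 y z where
    y: "y = c $ 2 + [:[:\<theta>:]:] * c $ 3 + [:[:\<mu>:]:] * c $ 4" and
    z: "z = c $ 3 + [:[:\<nu>:]:] * c $ 4 + [:[:\<kappa>:]:] * y" and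
    h: "1 = h1 * x + h2 * y + h3 * z" "total_degree h1 \<le> 4 * d\<^sup>2 + 4 * d"
      "total_degree h2 \<le> 4 * d\<^sup>2 + 4 * d" "total_degree h3 \<le> 4 * d\<^sup>2 + 4 * d"
    using bounded_unit_combination[OF inf n deg deg deg, of 3 4 2] one by metis
  have const: "total_degree [:[:e:]:] \<le> 0" for e :: 'k
    using total_degree_const[of "[:e:]"] by simp
  have cmult: "total_degree ([:[:e:]:] * f) \<le> d" if "total_degree f \<le> d" for e :: 'k and f
    using total_degree_mult_le[OF const that] by simp
  have ydeg: "total_degree y \<le> d" unfolding y by (intro total_degree_add_le cmult deg)
  have zdeg: "total_degree z \<le> d" unfolding z by (intro total_degree_add_le cmult deg ydeg)
  define c' where "c' = (\<chi> k. if k = 2 then y else c $ k)"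
  define c'' where "c'' = (\<chi> k. if k = 3 then z else c' $ k)"
  define c''' where "c''' = (\<chi> k. if k = 4 then 1 else c'' $ k)"
  have "total_degree (c''' $ i) \<le> d" for i
    using deg ydeg zdeg by (simp add: c'_def c''_def c'''_def)
  then have c''': "syz_basis_le c''' d"
    by (intro syz_basis_le_unit_entry[of _ 4]) (simp add: c'''_def)
  \<comment> \<open>The factor \<open>1 - c $ 4\<close> times the identity
    \<open>1 = h1 * x + h2 * y + h3 * z\<close> is exactly what must be added to
    \<open>c $ 4\<close>.\<close>
  define p where "p j = (if j = (4::4) then 0 else
    (1 - c $ 4) * (if j = 1 then h1 else if j = 2 then h2 else h3))" for j
  define p' :: "4 \<Rightarrow> 'k poly2"
    where "p' j = (if j = 4 then [:[:\<nu>:]:] else if j = 2 then [:[:\<kappa>:]:] else 0)" for j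
  define p'' :: "4 \<Rightarrow> 'k poly2"
    where "p'' j = (if j = 3 then [:[:\<theta>:]:] else if j = 4 then [:[:\<mu>:]:] else 0)" for j
  have c'': "syz_basis_le c'' (d + (d + (4 * d\<^sup>2 + 4 * d)))"
  proof (rule syz_basis_le_add_combination[OF _ _ c''', where h = p and i = 4])
    have "(\<Sum>j\<in>UNIV. p j * c'' $ j) = (1 - c $ 4) * (h1 * x + h2 * y + h3 * z)"
      by (simp add: c'_def c''_def p_def sum_4 ne x distrib_left mult.assoc)
    also have "\<dots> = 1 - c $ 4" by (simp flip: h(1))
    finally have "c'' $ 4 + (\<Sum>j\<in>UNIV. p j * c'' $ j) = 1" by (simp add: c'_def c''_def ne)
    then show "c''' = (\<chi> k. if k = 4 then c'' $ 4 + (\<Sum>j\<in>UNIV. p j * c'' $ j) else c'' $ k)"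
      unfolding c'''_def by presburger
    show "total_degree (p j) \<le> d + (4 * d\<^sup>2 + 4 * d)" for j
    proof -
      have "total_degree (1 - c $ 4) \<le> d" by (intro total_degree_diff_le deg) simp
      note m = total_degree_mult_le[OF this]
      show ?thesis
        using m[OF h(2)] m[OF h(3)] m[OF h(4)] by (simp add: p_def)
    qed
  qed (simp add: p_def)
  have c': "syz_basis_le c' (d + (d + (4 * d\<^sup>2 + 4 * d)) + 0)"
  proof (rule syz_basis_le_add_combination[OF _ _ c'', where h = p' and i = 3])
    show "c'' = (\<chi> k. if k = 3 then c' $ 3 + (\<Sum>j\<in>UNIV. p' j * c' $ j) else c' $ k)"
    proof -
      have "z = c' $ 3 + (\<Sum>j\<in>UNIV. p' j * c' $ j)"
        by (simp add: c'_def p'_def sum_4 ne z algebra_simps)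
      then show ?thesis unfolding c''_def by presburger
    qed
    show "total_degree (p' j) \<le> 0" for j
      unfolding p'_def using const by (auto simp del: le_zero_eq)
  qed (simp add: p'_def)
  have "syz_basis_le c (d + (d + (4 * d\<^sup>2 + 4 * d)) + 0 + 0)"
  proof (rule syz_basis_le_add_combination[OF _ _ c', where h = p'' and i = 2])
    show "c' = (\<chi> k. if k = 2 then c $ 2 + (\<Sum>j\<in>UNIV. p'' j * c $ j) else c $ k)"
    proof -
      have "y = c $ 2 + (\<Sum>j\<in>UNIV. p'' j * c $ j)"
        by (simp add: p''_def sum_4 ne y algebra_simps)
      then show ?thesis unfolding c'_def by presburger
    qed
    show "total_degree (p'' j) \<le> 0" for j
      unfolding p''_def using const by (auto simp del: le_zero_eq)
  qed (simp add: p''_def)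
  then show ?thesis by (rule syz_basis_le_mono) simp
qed

text \<open>A nonzero entry is moved to the front and made monic in \<open>t\<close>. The
  substitution and its inverse have total degree at most 1, so the bound is unchanged.\<close>

lemma syz_basis_le_unimodular:
  fixes c :: "'k::field poly2 ^ 4"
  assumes inf: "infinite (UNIV :: 'k set)"
    and deg: "\<And>i. total_degree (c $ i) \<le> d" and one: "1 \<in> ideal_gen (range (($) c))"
  shows "syz_basis_le c (4 * d\<^sup>2 + 6 * d)"
proof -
  have main: "syz_basis_le c (4 * d\<^sup>2 + 6 * d)"
    if deg: "\<And>i. total_degree (c $ i) \<le> d" and one: "1 \<in> ideal_gen (range (($) c))"
      and nz: "c $ 1 \<noteq> 0" for c :: "'k poly2 ^ 4"
  proof -
    obtain e l where e: "monic_in_t (subst2 [:[:0, 1:], [:e:]:] var_t (c $ 1)) (total_degree (c $ 1)) l"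
      using exists_monic_substitution[OF inf nz] by blast
    define X :: "'k \<Rightarrow> 'k poly2" where "X b = [:[:0, 1:], [:b:]:]" for b
    have X: "total_degree (X b) \<le> 1" for b
      by (auto simp: X_def total_degree_le_iff coeff_pCons split: nat.splits)
    have inv: "subst2 (X b) var_t (subst2 (X (- b)) var_t f) = f" for b f
    proof -
      have "subst2 (X b) var_t (X (- b)) = [:[:0, 1:]:]"
        by (simp add: X_def subst2_linear)
      then show ?thesis by (simp add: subst2_subst2 subst2_var_t)
    qed
    define c' where "c' = (\<chi> i. subst2 (X e) var_t (c $ i))"
    have "syz_basis_le c' (4 * d\<^sup>2 + 6 * d)"
    proof (rule monic_in_t.syz_basis_le_unimodular_monic[OF e inf deg])
      show "c' $ 1 = subst2 [:[:0, 1:], [:e:]:] var_t (c $ 1)" by (simp add: c'_def X_def)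
      show "total_degree (c' $ i) \<le> d" for i
        using order_trans[OF total_degree_subst2_le[OF X total_degree_var_t_le]] deg
        by (simp add: c'_def)
      obtain u where "1 = (\<Sum>i\<in>UNIV. u i * c $ i)" using one by (auto simp: ideal_gen_range)
      then have "1 = (\<Sum>i\<in>UNIV. subst2 (X e) var_t (u i) * c' $ i)"
        by (simp add: c'_def flip: subst2_mult subst2_sum)
      then show "1 \<in> ideal_gen (range (($) c'))"
        unfolding ideal_gen_range by (intro exI)
    qed
    then have "syz_basis_le c (1 * (4 * d\<^sup>2 + 6 * d))"
      unfolding c'_def
      by (intro syz_basis_le_subst2[OF _ _ _ X[of "- e"] total_degree_var_t_le])
        (use inv[of e] inv[of "- e"] in auto)
    then show ?thesis by simp
  qed
  have "\<exists>i. c $ i \<noteq> 0"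
  proof (rule ccontr)
    assume "\<not> ?thesis"
    moreover obtain u where "1 = (\<Sum>i\<in>UNIV. u i * c $ i)"
      using one by (auto simp: ideal_gen_range)
    ultimately show False by simp
  qed
  then obtain i where i: "c $ i \<noteq> 0" by blast
  define \<pi> where "\<pi> k = (if k = 1 then i else if k = i then 1 else k)" for k
  have \<pi>: "bij \<pi>" unfolding \<pi>_def by (rule bij_swap)
  show ?thesis
  proof (rule syz_basis_le_permute[OF \<pi>], rule main)
    show "1 \<in> ideal_gen (range (($) (\<chi> i. c $ \<pi> i)))"
      unfolding range_vec_bij[OF \<pi>] by (rule one)
  qed (simp_all add: deg i \<pi>_def)
qed

text \<open>Elementary operations make the third entry equal to \<open>g\<close> modulo
  \<open>t\<close> and the others divisible by \<open>t\<close>. After division by \<open>t\<close>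
  the row is unimodular with entries of degree at most \<open>6 * E\<close>; the other terms of the
  bound cover this division and the operations.\<close>

lemma syz_basis_le_unimodular_mod_t:
  fixes a :: "'k::field poly2 ^ 4" and \<beta> :: "4 \<Rightarrow> 'k poly"
  assumes inf: "infinite (UNIV :: 'k set)" and "0 < E"
    and deg: "\<And>i. total_degree (a $ i) \<le> E" and \<beta>deg: "\<And>i. degree (\<beta> i) \<le> E"
    and g: "g \<noteq> 0" "\<And>i. coeff (a $ i) 0 = \<beta> i * g"
    and unit: "1 \<in> ideal_gen (insert var_t (range (\<lambda>i. [:\<beta> i:])))"
    and t: "var_t \<in> ideal_gen (range (($) a))"
  shows "syz_basis_le a (144 * E\<^sup>2 + 43 * E + 2)"
proof -
  note ne = distinct_4 distinct_4[symmetric]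
  have main: "syz_basis_le a (144 * E\<^sup>2 + 43 * E + 2)"
    if deg: "\<And>i. total_degree (a $ i) \<le> E" and \<beta>deg: "\<And>i. degree (\<beta> i) \<le> E"
    and g2: "\<And>i. coeff (a $ i) 0 = \<beta> i * g"
    and unit: "1 \<in> ideal_gen (insert var_t (range (\<lambda>i. [:\<beta> i:])))"
    and t: "var_t \<in> ideal_gen (range (($) a))" and nz: "\<beta> 1 \<noteq> 0"
    for a :: "'k poly2 ^ 4" and \<beta> :: "4 \<Rightarrow> 'k poly"
  proof -
    \<comment> \<open>Working modulo \<open>t\<close> turns statements about the
      \<open>\<beta> i\<close> in \<open>K[s]\<close> into instances of the results for polynomials
      monic in \<open>t\<close>, with \<open>\<beta> 1\<close> as \<open>\<rho>\<close>.\<close>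
    interpret T: monic_in_t "var_t :: 'k poly2" 1 1
    proof unfold_locales
      show "total_degree (var_t :: 'k poly2) \<le> 1" by (rule total_degree_var_t_le)
    qed (simp_all flip: one_pCons)
    have "insert var_t (range (\<lambda>i. [:\<beta> i:])) = {[:\<beta> 3:], [:\<beta> 4:], [:\<beta> 2:], var_t, [:\<beta> 1:]}"
      unfolding UNIV_4 by auto
    then have "1 \<in> ideal_gen {[:\<beta> 3:], [:\<beta> 4:], [:\<beta> 2:], var_t, [:\<beta> 1:]}" using unit by simp
    then obtain \<mu> where "1 \<in> ideal_gen {[:\<beta> 3:] + [:[:\<mu>:]:] * [:\<beta> 4:], [:\<beta> 2:], var_t, [:\<beta> 1:]}"
      using T.exists_unit_combination[OF inf nz, of "{[:\<beta> 2:], var_t, [:\<beta> 1:]}"] by blast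
    then have "1 \<in> ideal_gen {[:\<beta> 2:], [:\<beta> 3:] + [:[:\<mu>:]:] * [:\<beta> 4:], var_t, [:\<beta> 1:]}"
      by (simp only: insert_commute)
    then obtain \<nu> where "1 \<in> ideal_gen {[:\<beta> 2:] + [:[:\<nu>:]:] * ([:\<beta> 3:] + [:[:\<mu>:]:] * [:\<beta> 4:]),
        var_t, [:\<beta> 1:]}"
      using T.exists_unit_combination[OF inf nz, of "{var_t, [:\<beta> 1:]}"] by blast
    moreover define b where "b = \<beta> 2 + smult \<nu> (\<beta> 3) + smult (\<nu> * \<mu>) (\<beta> 4)"
    then have "[:\<beta> 2:] + [:[:\<nu>:]:] * ([:\<beta> 3:] + [:[:\<mu>:]:] * [:\<beta> 4:]) = [:b:]"
      by (simp add: smult_add_right)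
    ultimately have bez: "1 \<in> ideal_gen {[:b:], var_t, [:\<beta> 1:]}" by simp
    have bdeg: "degree b \<le> E"
      unfolding b_def using \<beta>deg by (intro degree_add_le order_trans[OF degree_smult_le])
    obtain e2 A e1 where e: "1 = e2 * [:b:] + A * var_t + e1 * [:\<beta> 1:]"
      "total_degree e2 \<le> 1 + E + E" "total_degree e1 \<le> 1 + E + E"
      using T.bounded_bezout[OF nz \<beta>deg[of 1] order_trans[OF total_degree_const bdeg] bez] by blast
    have e0: "1 = coeff e2 0 * b + coeff e1 0 * \<beta> 1"
      using arg_cong[OF e(1), of "\<lambda>f. coeff f 0"] by (simp add: coeff_mult del: mult_pCons_left mult_pCons_right)
    define a1 where "a1 = (\<chi> k. if k = 2 then a $ 2 + [:[:\<nu>:]:] * a $ 3 + [:[:\<nu> * \<mu>:]:] * a $ 4 else a $ k)"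
    \<comment> \<open>At \<open>t = 0\<close> the added term is \<open>(1 - \<beta> 3) * g\<close>,
      by the Bezout identity for \<open>\<beta> 1\<close> and \<open>b\<close>; hence
      \<open>m\<close> becomes \<open>g\<close> there.\<close>
    define m where "m = a $ 3 + [:1 - \<beta> 3:] * (e1 * a1 $ 1 + e2 * a1 $ 2)"
    define a2 where "a2 = (\<chi> k. if k = 3 then m else a1 $ k)"
    define \<gamma> where "\<gamma> k = (if k = 2 then b else \<beta> k)" for k
    \<comment> \<open>Subtracting \<open>[:\<gamma> k:] * m\<close> cancels the value
      \<open>\<gamma> k * g\<close> of the \<open>k\<close>-th entry at
      \<open>t = 0\<close>.\<close>
    define a3 where "a3 = (\<chi> k. if k = 1 then a2 $ 1 - [:\<gamma> 1:] * m else a2 $ k)"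
    define a4 where "a4 = (\<chi> k. if k = 2 then a3 $ 2 - [:\<gamma> 2:] * m else a3 $ k)"
    define a5 where "a5 = (\<chi> k. if k = 4 then a4 $ 4 - [:\<gamma> 4:] * m else a4 $ k)"
    have const: "total_degree [:[:c:]:] \<le> 0" for c :: 'k
      using total_degree_const[of "[:c:]"] by simp
    have a1deg: "total_degree (a1 $ k) \<le> E" for k
    proof -
      have "total_degree ([:[:c:]:] * a $ k) \<le> E" for c k
        using total_degree_mult_le[OF const deg] by simp
      then show ?thesis unfolding a1_def using deg by (auto intro!: total_degree_add_le simp del: mult_pCons_left)
    qed
    have a1c: "coeff (a1 $ k) 0 = \<gamma> k * g" for k
      by (simp add: a1_def \<gamma>_def g2 b_def algebra_simps)
    have \<gamma>deg: "total_degree [:\<gamma> k:] \<le> E" for k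
      using \<beta>deg bdeg by (auto simp: \<gamma>_def intro: order_trans[OF total_degree_const])
    have 1: "total_degree [:1 - \<beta> 3:] \<le> E"
      using \<beta>deg by (intro order_trans[OF total_degree_const] degree_diff_le) auto
    have f: "total_degree ([:1 - \<beta> 3:] * e1) \<le> E + (1 + E + E)" "total_degree ([:1 - \<beta> 3:] * e2) \<le> E + (1 + E + E)"
      by (rule total_degree_mult_le[OF 1 e(3)], rule total_degree_mult_le[OF 1 e(2)])
    have mdeg: "total_degree m \<le> 4 * E + 1"
    proof -
      have "total_degree (e1 * a1 $ 1) \<le> 3 * E + 1" "total_degree (e2 * a1 $ 2) \<le> 3 * E + 1"
        using total_degree_mult_le[OF e(3) a1deg[of 1]] total_degree_mult_le[OF e(2) a1deg[of 2]]
        by simp_all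
      then have "total_degree ([:1 - \<beta> 3:] * (e1 * a1 $ 1 + e2 * a1 $ 2)) \<le> E + (3 * E + 1)"
        by (intro total_degree_mult_le[OF 1] total_degree_add_le)
      then show ?thesis unfolding m_def using deg[of 3] by (intro total_degree_add_le) auto
    qed
    have mc: "coeff m 0 = g"
    proof -
      have "coeff m 0 = \<beta> 3 * g + (1 - \<beta> 3) * (coeff e2 0 * b + coeff e1 0 * \<beta> 1) * g"
        by (simp add: m_def g2 coeff_mult_0 a1c \<gamma>_def algebra_simps)
      then show ?thesis unfolding e0[symmetric] by (simp add: algebra_simps)
    qed
    have diff: "total_degree (f - [:\<gamma> k:] * m) \<le> 5 * E + 1" if "total_degree f \<le> E" for f k
      using total_degree_mult_le[OF \<gamma>deg mdeg] that by (intro total_degree_diff_le) auto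
    have a5: "a5 $ k = (if k = 3 then m else a1 $ k - [:\<gamma> k:] * m)" for k
      using exhaust_4[of k] by (auto simp: a2_def a3_def a4_def a5_def ne)
    have a5deg: "total_degree (a5 $ k) \<le> 6 * E" for k
      using order_trans[OF diff[OF a1deg[of k]], of "6 * E" k] mdeg \<open>0 < E\<close> unfolding a5 by auto
    define p1 where "p1 j = (if j = (3::4) then [:[:\<nu>:]:] else if j = 4 then [:[:\<nu> * \<mu>:]:] else 0)" for j
    define p2 where "p2 j = (if j = (1::4) then [:1 - \<beta> 3:] * e1 else if j = 2 then [:1 - \<beta> 3:] * e2 else 0)" for j
    define p3 where "p3 k j = (if j = (3::4) then - [:\<gamma> k:] else 0)" for k j
    have a1': "a1 = (\<chi> k. if k = 2 then a $ 2 + (\<Sum>j\<in>UNIV. p1 j * a $ j) else a $ k)"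
      by (simp add: a1_def p1_def sum_4 ne add.assoc cong: if_cong)
    have a2': "a2 = (\<chi> k. if k = 3 then a1 $ 3 + (\<Sum>j\<in>UNIV. p2 j * a1 $ j) else a1 $ k)"
    proof -
      have "a1 $ 3 + (\<Sum>j\<in>UNIV. p2 j * a1 $ j) = m"
        unfolding m_def p2_def by (simp add: a1_def sum_4 ne distrib_left mult.assoc del: mult_pCons_left)
      then show ?thesis unfolding a2_def by presburger
    qed
    have p3: "w + (\<Sum>j\<in>UNIV. p3 k j * v $ j) = w - [:\<gamma> k:] * m" if "v $ 3 = m" for k v w
      by (simp add: p3_def sum_4 ne that)
    have a3': "a3 = (\<chi> k. if k = 1 then a2 $ 1 + (\<Sum>j\<in>UNIV. p3 1 j * a2 $ j) else a2 $ k)"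
      by (subst p3) (simp_all add: a3_def a2_def)
    have a4': "a4 = (\<chi> k. if k = 2 then a3 $ 2 + (\<Sum>j\<in>UNIV. p3 2 j * a3 $ j) else a3 $ k)"
      by (subst p3) (simp_all add: a4_def a3_def a2_def)
    have a5': "a5 = (\<chi> k. if k = 4 then a4 $ 4 + (\<Sum>j\<in>UNIV. p3 4 j * a4 $ j) else a4 $ k)"
      by (subst p3) (simp_all add: a5_def a4_def a3_def a2_def)
    have p0: "p1 2 = 0" "p2 3 = 0" "p3 1 1 = 0" "p3 2 2 = 0" "p3 4 4 = 0"
      by (simp_all add: p1_def p2_def p3_def ne)
    have p1deg: "total_degree (p1 j) \<le> 0" for j
      unfolding p1_def using const by (simp del: le_zero_eq)
    have p2deg: "total_degree (p2 j) \<le> E + (1 + E + E)" for j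
      unfolding p2_def using f by (simp del: mult_pCons_left)
    have p3deg: "total_degree (p3 k j) \<le> E" for k j
      using \<gamma>deg[of k] total_degree_minus[of "[:\<gamma> k:]"] by (simp add: p3_def)
    have t5: "var_t \<in> ideal_gen (range (($) a5))"
      using t ideal_gen_add_combination[OF p0(1) a1'] ideal_gen_add_combination[OF p0(2) a2']
        ideal_gen_add_combination[OF p0(3) a3'] ideal_gen_add_combination[OF p0(4) a4']
        ideal_gen_add_combination[OF p0(5) a5'] by blast
    have c5: "coeff (a5 $ k) 0 = (if k = 3 then g else 0)" for k
      by (simp add: a5 mc a1c)
    define c where "c = (\<chi> k. if k = 3 then m else poly_shift 1 (a5 $ k))"
    have shift: "var_t * poly_shift 1 f = f" if "coeff f 0 = 0" for f :: "'k poly2"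
      using that by (intro poly_eqI) (simp add: coeff_pCons coeff_poly_shift split: nat.splits)
    have ca: "a5 $ k = var_t * c $ k" if "k \<noteq> 3" for k
      using that shift[of "a5 $ k"] c5[of k] by (simp add: c_def del: mult_pCons_left)
    have c3: "c $ 3 = a5 $ 3" by (simp add: c_def a5)
    have "syz_basis_le c (4 * (6 * E)\<^sup>2 + 6 * (6 * E))"
    proof (rule syz_basis_le_unimodular[OF inf])
      show "total_degree (c $ k) \<le> 6 * E" for k
      proof (cases "k = 3")
        case False
        have "i + j \<le> 6 * E" if "coeff (coeff (poly_shift 1 (a5 $ k)) i) j \<noteq> 0" for i j
          using that total_degree_coeff_le[of "a5 $ k" "Suc i" j] a5deg[of k]
          by (simp add: coeff_poly_shift)
        then show ?thesis using False by (simp add: c_def total_degree_le_iff)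
      qed (use a5deg c3 in auto)
      \<comment> \<open>At \<open>t = 0\<close> the expression for \<open>t\<close> leaves only its
        third term, so \<open>u 3\<close> is divisible by \<open>t\<close>. So is every other
        \<open>a5 $ k\<close>; dividing the identity by \<open>t\<close> exhibits \<open>1\<close>
        in the ideal of \<open>c\<close>.\<close>
      obtain u where u: "var_t = (\<Sum>k\<in>UNIV. u k * a5 $ k)" using t5 by (auto simp: ideal_gen_range)
      have "0 = coeff (\<Sum>k\<in>UNIV. u k * a5 $ k) 0" unfolding u[symmetric] by simp
      also have "\<dots> = coeff (u 3) 0 * g"
        by (simp add: coeff_sum coeff_mult_0 c5 sum_4 ne)
      finally have "coeff (u 3) 0 = 0" using g(1) by simp
      then have u3: "u 3 = var_t * poly_shift 1 (u 3)" using shift by simp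
      define v where "v k = (if k = 3 then poly_shift 1 (u 3) else u k)" for k
      have uv: "u k * a5 $ k = var_t * (v k * c $ k)" for k
      proof (cases "k = 3")
        case True
        have "u 3 * a5 $ 3 = var_t * poly_shift 1 (u 3) * a5 $ 3"
          using arg_cong[OF u3, of "\<lambda>f. f * a5 $ 3"] .
        then show ?thesis unfolding True c3 v_def by (simp only: if_True mult.assoc refl simp_thms)
      next
        case False
        then show ?thesis by (simp add: v_def ca mult_ac del: mult_pCons_left)
      qed
      have "var_t * 1 = (\<Sum>k\<in>UNIV. u k * a5 $ k)" unfolding mult_1_right by (rule u)
      also have "\<dots> = var_t * (\<Sum>k\<in>UNIV. v k * c $ k)" by (simp only: uv sum_distrib_left)
      finally have "1 = (\<Sum>k\<in>UNIV. v k * c $ k)"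
        unfolding mult_cancel_left by simp
      then show "1 \<in> ideal_gen (range (($) c))" unfolding ideal_gen_range by (intro exI)
    qed
    \<comment> \<open>From here the operations are undone in reverse order, each adding the degree
      of its coefficients.\<close>
    from syz_basis_le_divide_t[OF c3 _ ca this]
    have "syz_basis_le a5 (4 * (6 * E)\<^sup>2 + 6 * (6 * E) + 1)"
      using g(1) c5[of 3] by simp
    from syz_basis_le_add_combination[OF p0(5) a5' this p3deg]
    have "syz_basis_le a4 (4 * (6 * E)\<^sup>2 + 6 * (6 * E) + 1 + E)" .
    from syz_basis_le_add_combination[OF p0(4) a4' this p3deg]
    have "syz_basis_le a3 (4 * (6 * E)\<^sup>2 + 6 * (6 * E) + 1 + E + E)" .
    from syz_basis_le_add_combination[OF p0(3) a3' this p3deg]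
    have "syz_basis_le a2 (4 * (6 * E)\<^sup>2 + 6 * (6 * E) + 1 + E + E + E)" .
    from syz_basis_le_add_combination[OF p0(2) a2' this p2deg]
    have "syz_basis_le a1 (4 * (6 * E)\<^sup>2 + 6 * (6 * E) + 1 + E + E + E + (E + (1 + E + E)))" .
    from syz_basis_le_add_combination[OF p0(1) a1' this p1deg]
    have "syz_basis_le a (4 * (6 * E)\<^sup>2 + 6 * (6 * E) + 1 + E + E + E + (E + (1 + E + E)) + 0)" .
    then show ?thesis by (rule syz_basis_le_mono) (simp add: power_mult_distrib)
  qed
  have "\<exists>i. \<beta> i \<noteq> 0"
  proof (rule ccontr)
    assume "\<not> (\<exists>i. \<beta> i \<noteq> 0)"
    then have "ideal_gen (insert var_t (range (\<lambda>i. [:\<beta> i:]))) \<subseteq> ideal_gen {var_t}"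
      by (intro ideal_gen_minimal) (auto intro: ideal_gen_base ideal_gen_zero)
    then have "(1 :: 'k poly2) \<in> ideal_gen {var_t}" using unit by blast
    then obtain k where "1 = k * (var_t :: 'k poly2)"
      by (auto simp: ideal_gen_insert ideal_gen_empty simp del: mult_pCons_right)
    then have "coeff (1 :: 'k poly2) 0 = coeff (k * var_t) 0" by (simp only:)
    then show False by (simp add: coeff_mult_0 del: mult_pCons_right)
  qed
  then obtain i where i: "\<beta> i \<noteq> 0" by blast
  define \<pi> where "\<pi> k = (if k = 1 then i else if k = i then 1 else k)" for k
  have \<pi>: "bij \<pi>" unfolding \<pi>_def by (rule bij_swap)
  show ?thesis
  proof (rule syz_basis_le_permute[OF \<pi>], rule main[where \<beta> = "\<beta> \<circ> \<pi>"])
    show "var_t \<in> ideal_gen (range (($) (\<chi> i. a $ \<pi> i)))"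
      unfolding range_vec_bij[OF \<pi>] by (rule t)
    have "range (\<lambda>i. [:(\<beta> \<circ> \<pi>) i:]) = (\<lambda>i. [:\<beta> i:]) ` range \<pi>" by auto
    then show "1 \<in> ideal_gen (insert var_t (range (\<lambda>i. [:(\<beta> \<circ> \<pi>) i:])))"
      using unit \<pi> by (simp add: bij_is_surj)
  qed (use deg \<beta>deg g i in \<open>simp_all add: \<pi>_def\<close>)
qed

section \<open>From a shape basis to the ideal generated by \<open>t\<close> and
  \<open>g\<close>\<close>

theorem proposition7p1:
  fixes a :: "('k::field poly2) ^ 4"
    and p q :: "'k poly2"
    and \<delta>\<^sub>a \<delta>\<^sub>0 :: nat
  assumes "infinite (UNIV :: 'k set)"
    and "\<And>i. total_degree (a $ i) \<le> \<delta>\<^sub>a"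
    and "ideal_gen (range (($) a)) \<noteq> UNIV"
    and "is_shape_basis (ideal_gen (range (($) a))) p q"
    and "total_degree p \<le> \<delta>\<^sub>0" and "total_degree q \<le> \<delta>\<^sub>0"
  shows "\<exists>B. module_basis (Syz a) B \<and> (\<forall>v\<in>B. vec_degree v \<le> 192 * (\<delta>\<^sub>0 * \<delta>\<^sub>a + 1) ^ 4)"
proof -
  obtain r g where p: "p = var_t - [:r:]" and q: "q = [:g:]" and "coprime p q"
    and I: "ideal_gen (range (($) a)) = ideal_gen {p, q}"
    using assms(4) by (auto simp: is_shape_basis_def)
  have pc: "p = [:- r, 1:]" by (simp add: p)
  \<comment> \<open>Otherwise coprimality would make \<open>p\<close> a unit, although it has degree
    1 in \<open>t\<close>.\<close>
  have "g \<noteq> 0"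
  proof
    assume "g = 0"
    then have "p dvd 1" using \<open>coprime p q\<close> q by simp
    then obtain k where "1 = p * k" by blast
    then have *: "degree (p * k) = 0" "p \<noteq> 0" "k \<noteq> 0" by auto
    have "degree p = 1" by (simp add: pc)
    then show False using degree_mult_eq[OF *(2,3)] *(1) by linarith
  qed
  have "0 < \<delta>\<^sub>0"
    using total_degree_coeff_le[of p 1 0] assms(5) by (simp add: pc)
  have pI: "p \<in> ideal_gen (range (($) a))" "q \<in> ideal_gen (range (($) a))"
    unfolding I by (auto intro: ideal_gen_base)
  \<comment> \<open>Constant entries would generate the zero ideal or the whole ring, but the ideal
    contains \<open>p \<noteq> 0\<close> and is proper.\<close>
  have "0 < \<delta>\<^sub>a"
  proof (rule ccontr)
    assume "\<not> 0 < \<delta>\<^sub>a"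
    then have zero: "total_degree (a $ i) = 0" for i using assms(2)[of i] by simp
    obtain u where u: "p = (\<Sum>i\<in>UNIV. u i * a $ i)" using pI(1) by (auto simp: ideal_gen_range)
    have "\<exists>i. a $ i \<noteq> 0"
    proof (rule ccontr)
      assume "\<not> ?thesis"
      then have "p = 0" using u by simp
      then show False by (simp add: pc)
    qed
    then obtain i where i: "a $ i \<noteq> 0" by blast
    have "degree (a $ i) = 0" using degree_le_total_degree[of "a $ i"] zero[of i] by simp
    then obtain h where h: "a $ i = [:h:]" by (rule degree_eq_zeroE)
    have "degree h = 0" using degree_coeff_le_total_degree[of "a $ i" 0] zero[of i] h by simp
    then obtain c where c: "h = [:c:]" by (rule degree_eq_zeroE)
    have "[:[:1 / c:]:] * a $ i = 1" using i h c by (simp flip: one_pCons)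
    then have "ideal_gen (range (($) a)) = UNIV"
      by (rule ideal_gen_unit[OF ideal_gen_base, rotated]) simp
    then show False using assms(3) by simp
  qed
  define E where "E = \<delta>\<^sub>0 * \<delta>\<^sub>a"
  have "0 < E" using \<open>0 < \<delta>\<^sub>0\<close> \<open>0 < \<delta>\<^sub>a\<close> by (simp add: E_def)
  have "degree r \<le> \<delta>\<^sub>0"
    using degree_coeff_le_total_degree[of p 0] assms(5) by (simp add: pc)
  then have lin: "total_degree [:r, 1:] \<le> \<delta>\<^sub>0" "total_degree [:- r, 1:] \<le> \<delta>\<^sub>0"
    using \<open>0 < \<delta>\<^sub>0\<close> by (auto simp: total_degree_le_iff coeff_pCons dest: le_degree split: nat.splits)
  define X :: "'k poly2" where "X = [:[:0, 1:]:]"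
  have X: "total_degree X \<le> \<delta>\<^sub>0"
    using \<open>0 < \<delta>\<^sub>0\<close> total_degree_const[of "[:0, 1 :: 'k:]"] by (simp add: X_def)
  have const: "subst2 X Y [:f:] = [:f:]" for Y f
    unfolding X_def by (rule subst2_const)
  have lin_subst: "subst2 X Y [:f, 1:] = [:f:] + Y" for Y f
  proof -
    have "[:f, 1:] = [:f:] + var_t" by simp
    then show ?thesis by (simp only: subst2_add const subst2_var_t)
  qed
  have inv: "subst2 X [:h, 1:] (subst2 X [:- h, 1:] f) = f" for f h
  proof -
    have "subst2 X [:h, 1:] X = X" "subst2 X [:h, 1:] [:- h, 1:] = var_t"
      using const lin_subst[of "[:h, 1:]" "- h"] by (simp_all add: X_def)
    then show ?thesis by (simp add: subst2_subst2 X_def)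
  qed
  \<comment> \<open>\<open>S\<close> replaces \<open>t\<close> by \<open>t + r\<close>; it fixes
    \<open>K[s]\<close> and sends \<open>p\<close> to \<open>t\<close>.\<close>
  define S where "S = subst2 X [:r, 1:]"
  have S: "S (f + f') = S f + S f'" "S (f * f') = S f * S f'" "S (sum \<phi> A) = (\<Sum>i\<in>A. S (\<phi> i))"
    for f f' and \<phi> :: "4 \<Rightarrow> 'k poly2" and A
    by (simp_all add: S_def subst2_add subst2_mult subst2_sum)
  have Sp: "S p = var_t" and Sq: "S q = [:g:]"
    using lin_subst[of "[:r, 1:]" "- r"] const by (simp_all add: S_def pc q)
  define a' where "a' = (\<chi> i. S (a $ i))"
  have "\<forall>i. \<exists>b. coeff (a' $ i) 0 = b * g"
  proof
    fix i
    have "a $ i \<in> ideal_gen {p, q}" unfolding I[symmetric] by (auto intro: ideal_gen_base)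
    then obtain \<alpha> \<beta> where "a $ i = \<alpha> * p + \<beta> * q"
      by (auto simp: ideal_gen_insert ideal_gen_empty algebra_simps)
    then have "a' $ i = S \<alpha> * var_t + S \<beta> * [:g:]"
      by (simp only: a'_def vec_lambda_beta S Sp Sq)
    then have "coeff (a' $ i) 0 = coeff (S \<beta>) 0 * g"
      by (simp only: coeff_add coeff_mult_0) simp
    then show "\<exists>b. coeff (a' $ i) 0 = b * g" ..
  qed
  then obtain \<beta> where \<beta>: "\<And>i. coeff (a' $ i) 0 = \<beta> i * g" by metis
  have a'deg: "total_degree (a' $ i) \<le> E" for i
    using order_trans[OF total_degree_subst2_le[OF X lin(1)] mult_le_mono2[OF assms(2)]]
    by (simp add: a'_def S_def E_def)
  have \<beta>deg: "degree (\<beta> i) \<le> E" for i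
  proof (cases "\<beta> i = 0")
    case False
    then have "degree (\<beta> i) \<le> degree (coeff (a' $ i) 0)"
      using \<open>g \<noteq> 0\<close> by (simp add: \<beta> degree_mult_eq)
    then show ?thesis
      using degree_coeff_le_total_degree[of "a' $ i" 0] a'deg[of i] by linarith
  qed simp
  have SI: "S f \<in> ideal_gen (range (($) a'))" if "f \<in> ideal_gen (range (($) a))" for f
  proof -
    obtain u where "f = (\<Sum>i\<in>UNIV. u i * a $ i)" using \<open>f \<in> _\<close> by (auto simp: ideal_gen_range)
    then have "S f = (\<Sum>i\<in>UNIV. S (u i) * a' $ i)" by (simp add: S a'_def)
    then show ?thesis unfolding ideal_gen_range by (intro exI)
  qed
  have t: "var_t \<in> ideal_gen (range (($) a'))" using SI[OF pI(1)] Sp by simp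
  have unit: "1 \<in> ideal_gen (insert var_t (range (\<lambda>i. [:\<beta> i:])))"
  proof -
    obtain u where u: "[:g:] = (\<Sum>i\<in>UNIV. u i * a' $ i)"
      using SI[OF pI(2)] Sq by (auto simp: ideal_gen_range)
    \<comment> \<open>Setting \<open>t = 0\<close> in the expression for \<open>g\<close> and
      cancelling \<open>g\<close> shows that the \<open>\<beta> i\<close> generate the unit ideal of
      \<open>K[s]\<close>.\<close>
    have "g = coeff (\<Sum>i\<in>UNIV. u i * a' $ i) 0" unfolding u[symmetric] by simp
    also have "\<dots> = (\<Sum>i\<in>UNIV. coeff (u i) 0 * \<beta> i) * g"
      by (simp add: coeff_sum coeff_mult_0 \<beta> sum_distrib_right mult.assoc)
    finally have "1 = (\<Sum>i\<in>UNIV. coeff (u i) 0 * \<beta> i)" using \<open>g \<noteq> 0\<close> by simp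
    then have "1 = [:\<Sum>i\<in>UNIV. coeff (u i) 0 * \<beta> i:]" by (simp add: one_pCons)
    also have "\<dots> = (\<Sum>i\<in>UNIV. [:coeff (u i) 0:] * [:\<beta> i:])" by (simp add: sum_4)
    also have "\<dots> \<in> ideal_gen (insert var_t (range (\<lambda>i. [:\<beta> i:])))"
      by (intro ideal_gen_sum ideal_gen_mult ideal_gen_base) auto
    finally show ?thesis .
  qed
  have "syz_basis_le a' (144 * E\<^sup>2 + 43 * E + 2)"
    using syz_basis_le_unimodular_mod_t[OF assms(1) \<open>0 < E\<close> a'deg \<beta>deg \<open>g \<noteq> 0\<close> \<beta> unit t] .
  then have "syz_basis_le a (\<delta>\<^sub>0 * (144 * E\<^sup>2 + 43 * E + 2))"
    unfolding a'_def S_def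
    by (intro syz_basis_le_subst2[OF _ _ _ X lin(2)]) (use inv[of r] inv[of "- r"] in auto)
  \<comment> \<open>The factor \<open>\<delta>\<^sub>0\<close> comes from substituting back. It is
    at most \<open>E\<close> because \<open>\<delta>\<^sub>a\<close> is positive, which leaves a
    cubic in \<open>E\<close>.\<close>
  moreover have "\<delta>\<^sub>0 * (144 * E\<^sup>2 + 43 * E + 2) \<le> 192 * (E + 1) ^ 4"
  proof -
    have "\<delta>\<^sub>0 \<le> E" using \<open>0 < \<delta>\<^sub>a\<close> by (simp add: E_def)
    then have "\<delta>\<^sub>0 * (144 * E\<^sup>2 + 43 * E + 2) \<le> E * (144 * E\<^sup>2 + 43 * E + 2)"
      by (rule mult_le_mono1)
    also have "\<dots> \<le> 192 * (E + 1) ^ 4"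
      by (simp add: power4_eq_xxxx power2_eq_square algebra_simps)
    finally show ?thesis .
  qed
  ultimately show ?thesis
    using syz_basis_le_mono unfolding E_def syz_basis_le_def by blast
qed

end
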